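(* (Stallings Sequence) Let $Z$ be a central ideal of a Leibniz algebra $L$. Then the following sequence (with the maps described in the context) is exact: \[M(L)\to M(L/Z)\to Z\to L/L'\to\frac{L}{Z+L'}\to0.\]
   Context: A (left) Leibniz algebra over a field $\mathbb{F}$ is an $\mathbb{F}$-vector space with a bilinear multiplication satisfying $x(yz)=(xy)z+y(xz)$. $L'$ is the span of all products in $L$; $Z(L)=\{z: zx=xz=0\ \forall x\in L\}$; a central ideal is an ideal contained in $Z(L)$. Multiplier: a pair of Leibniz algebras $(K,M)$ is a defining pair for $L$ if $L\cong K/M$ and $M\subseteq Z(K)\cap K'$; it is a maximal defining pair if $\dim K$ is maximal, and then $M$ is called the multiplier of $L$, denoted $M(L)$. Maps: write $L=F/R$ and $Z=T/R$ with $F$ a free Leibniz algebra and $R\subseteq T$ ideals of $F$; then $FT+TF\subseteq R$, where $FT$, $TF$ (and similarly $FR$, $RF$) denote spans of products. Under the identifications $M(L)\cong(R\cap F')/(FR+RF)$, $M(L/Z)\cong(T\cap F')/(FT+TF)$, $Z\cong T/R$, $L/L'\cong F/(R+F')$, $L/(Z+L')\cong F/(T+F')$, the maps between these terms are those induced by the inclusions $R\cap F'\to T\cap F'\to T\to F\to F$. *)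

theory Defs
  imports "Jordan_Normal_Form.Missing_VectorSpace" "HOL-Algebra.QuotRing"
begin

text \<open>
  An algebra over \<open>K\<close> is a module record whose \<open>\<otimes>\<close> is the (non-associative)
  product. The field \<open>one\<close> of the record plays no role anywhere.
\<close>

locale leibniz_algebra = vectorspace K L for K and L (structure) +
  assumes prod_closed: "\<lbrakk>x \<in> carrier L; y \<in> carrier L\<rbrakk> \<Longrightarrow> x \<otimes>\<^bsub>L\<^esub> y \<in> carrier L"
    and prod_add_left: "\<lbrakk>x \<in> carrier L; y \<in> carrier L; z \<in> carrier L\<rbrakk> \<Longrightarrow>
      (x \<oplus>\<^bsub>L\<^esub> y) \<otimes>\<^bsub>L\<^esub> z = (x \<otimes>\<^bsub>L\<^esub> z) \<oplus>\<^bsub>L\<^esub> (y \<otimes>\<^bsub>L\<^esub> z)"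
    and prod_add_right: "\<lbrakk>x \<in> carrier L; y \<in> carrier L; z \<in> carrier L\<rbrakk> \<Longrightarrow>
      x \<otimes>\<^bsub>L\<^esub> (y \<oplus>\<^bsub>L\<^esub> z) = (x \<otimes>\<^bsub>L\<^esub> y) \<oplus>\<^bsub>L\<^esub> (x \<otimes>\<^bsub>L\<^esub> z)"
    and prod_smult_left: "\<lbrakk>a \<in> carrier K; x \<in> carrier L; y \<in> carrier L\<rbrakk> \<Longrightarrow>
      (a \<odot>\<^bsub>L\<^esub> x) \<otimes>\<^bsub>L\<^esub> y = a \<odot>\<^bsub>L\<^esub> (x \<otimes>\<^bsub>L\<^esub> y)"
    and prod_smult_right: "\<lbrakk>a \<in> carrier K; x \<in> carrier L; y \<in> carrier L\<rbrakk> \<Longrightarrow>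
      x \<otimes>\<^bsub>L\<^esub> (a \<odot>\<^bsub>L\<^esub> y) = a \<odot>\<^bsub>L\<^esub> (x \<otimes>\<^bsub>L\<^esub> y)"
    and leibniz: "\<lbrakk>x \<in> carrier L; y \<in> carrier L; z \<in> carrier L\<rbrakk> \<Longrightarrow>
      x \<otimes>\<^bsub>L\<^esub> (y \<otimes>\<^bsub>L\<^esub> z) = ((x \<otimes>\<^bsub>L\<^esub> y) \<otimes>\<^bsub>L\<^esub> z) \<oplus>\<^bsub>L\<^esub> (y \<otimes>\<^bsub>L\<^esub> (x \<otimes>\<^bsub>L\<^esub> z))"

definition prod_span :: "'k ring \<Rightarrow> ('k, 'a) module \<Rightarrow> 'a set \<Rightarrow> 'a set \<Rightarrow> 'a set" where
  "prod_span K L A B = module.span K L {a \<otimes>\<^bsub>L\<^esub> b | a b. a \<in> A \<and> b \<in> B}"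

definition derived_algebra :: "'k ring \<Rightarrow> ('k, 'a) module \<Rightarrow> 'a set" where
  "derived_algebra K L = prod_span K L (carrier L) (carrier L)"

definition leibniz_center :: "('k, 'a) module \<Rightarrow> 'a set" where
  "leibniz_center L =
    {z \<in> carrier L. \<forall>x\<in>carrier L. z \<otimes>\<^bsub>L\<^esub> x = \<zero>\<^bsub>L\<^esub> \<and> x \<otimes>\<^bsub>L\<^esub> z = \<zero>\<^bsub>L\<^esub>}"

definition leibniz_ideal :: "'k ring \<Rightarrow> 'a set \<Rightarrow> ('k, 'a) module \<Rightarrow> bool" where
  "leibniz_ideal K I L \<longleftrightarrow> subspace K I L \<and>
    (\<forall>x\<in>carrier L. \<forall>i\<in>I. x \<otimes>\<^bsub>L\<^esub> i \<in> I \<and> i \<otimes>\<^bsub>L\<^esub> x \<in> I)"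

definition central_ideal :: "'k ring \<Rightarrow> 'a set \<Rightarrow> ('k, 'a) module \<Rightarrow> bool" where
  "central_ideal K I L \<longleftrightarrow> leibniz_ideal K I L \<and> I \<subseteq> leibniz_center L"

definition subalg :: "('k, 'a) module \<Rightarrow> 'a set \<Rightarrow> ('k, 'a) module" where
  "subalg L A = L\<lparr>carrier := A\<rparr>"

text \<open>The ring part agrees with \<^const>\<open>FactRing\<close>.\<close>

definition quot_alg :: "('k, 'a) module \<Rightarrow> 'a set \<Rightarrow> ('k, 'a set) module" where
  "quot_alg L I =
    \<lparr>carrier = a_rcosets\<^bsub>L\<^esub> I, mult = rcoset_mult L I, one = I +>\<^bsub>L\<^esub> \<one>\<^bsub>L\<^esub>,
     zero = I, add = set_add L,
     smult = (\<lambda>a C. \<Union>x\<in>C. I +>\<^bsub>L\<^esub> (a \<odot>\<^bsub>L\<^esub> x))\<rparr>"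

definition leibniz_hom ::
    "'k ring \<Rightarrow> ('k, 'a) module \<Rightarrow> ('k, 'b) module \<Rightarrow> ('a \<Rightarrow> 'b) set" where
  "leibniz_hom K A B =
    {h \<in> module_hom K A B. \<forall>x\<in>carrier A. \<forall>y\<in>carrier A. h (x \<otimes>\<^bsub>A\<^esub> y) = h x \<otimes>\<^bsub>B\<^esub> h y}"

definition leibniz_iso ::
    "'k ring \<Rightarrow> ('k, 'a) module \<Rightarrow> ('k, 'b) module \<Rightarrow> ('a \<Rightarrow> 'b) set" where
  "leibniz_iso K A B = {h \<in> leibniz_hom K A B. bij_betw h (carrier A) (carrier B)}"

text \<open>
  \<open>F\<close> is free on \<open>X\<close>: every map from \<open>X\<close> into a Leibniz algebra extends uniquely to a
  homomorphism. HOL cannot quantify over the type of the target inside a definition, so the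
  targets are the Leibniz algebras carried by subsets of \<open>'a list \<Rightarrow> 'k\<close>. Among these is a
  copy of the free Leibniz algebra on \<open>X\<close>, since the latter has a basis indexed by the
  nonempty words over \<open>X\<close>. Uniqueness of the extension is stated as generation of \<open>F\<close> by \<open>X\<close>,
  which, unlike uniqueness for the targets considered here, gives it for targets of any size.
  Hence this agrees with the unrestricted universal property.
\<close>

definition free_leibniz_algebra :: "'k ring \<Rightarrow> ('k, 'a) module \<Rightarrow> 'a set \<Rightarrow> bool" where
  "free_leibniz_algebra K F X \<longleftrightarrow>
    leibniz_algebra K F \<and> X \<subseteq> carrier F \<and>
    (\<forall>S. subspace K S F \<and> X \<subseteq> S \<and> (\<forall>x\<in>S. \<forall>y\<in>S. x \<otimes>\<^bsub>F\<^esub> y \<in> S) \<longrightarrow> S = carrier F) \<and>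
    (\<forall>(A :: ('k, 'a list \<Rightarrow> 'k) module) f. leibniz_algebra K A \<and> f \<in> X \<rightarrow> carrier A \<longrightarrow>
      (\<exists>h\<in>leibniz_hom K F A. \<forall>x\<in>X. h x = f x))"

definition defining_pair ::
    "'k ring \<Rightarrow> ('k, 'l) module \<Rightarrow> ('k, 'c) module \<Rightarrow> 'c set \<Rightarrow> bool" where
  "defining_pair K L C M \<longleftrightarrow>
    leibniz_algebra K C \<and> leibniz_ideal K M C \<and>
    M \<subseteq> leibniz_center C \<inter> derived_algebra K C \<and>
    leibniz_iso K (quot_alg C M) L \<noteq> {}"

text \<open>
  The dimension is a natural number, so a maximal defining pair is finite-dimensional (and
  so is \<open>L\<close>). The competitors range over the algebras carried by subsets of \<open>nat \<Rightarrow> 'k\<close>,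
  which include a copy of every algebra of countable dimension over \<open>K\<close>. This is no
  restriction: if \<open>L\<close> is finite-dimensional, then so is \<open>D\<close> for every defining pair \<open>(D, N)\<close>
  of \<open>L\<close>, because \<open>N\<close> lies in the span of the products of lifts of a basis of \<open>L\<close>.
\<close>

definition maximal_defining_pair ::
    "'k ring \<Rightarrow> ('k, 'l) module \<Rightarrow> ('k, 'c) module \<Rightarrow> 'c set \<Rightarrow> bool" where
  "maximal_defining_pair K L C M \<longleftrightarrow>
    defining_pair K L C M \<and> vectorspace.fin_dim K C \<and>
    (\<forall>(D :: ('k, nat \<Rightarrow> 'k) module) N. defining_pair K L D N \<longrightarrow>
      vectorspace.fin_dim K D \<and> vectorspace.dim K D \<le> vectorspace.dim K C)"

definition is_multiplier :: "'k ring \<Rightarrow> ('k, 'l) module \<Rightarrow> ('k, 'm) module \<Rightarrow> bool" where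
  "is_multiplier K L B \<longleftrightarrow> (\<exists>C M. maximal_defining_pair K L C M \<and> B = subalg C M)"

text \<open>\<open>FR + RF\<close>\<close>

definition comm_ideal :: "'k ring \<Rightarrow> ('k, 'a) module \<Rightarrow> 'a set \<Rightarrow> 'a set" where
  "comm_ideal K F R = prod_span K F (carrier F) R <+>\<^bsub>F\<^esub> prod_span K F R (carrier F)"

text \<open>\<open>(R \<inter> F') / (FR + RF)\<close>\<close>

definition hopf_quot :: "'k ring \<Rightarrow> ('k, 'a) module \<Rightarrow> 'a set \<Rightarrow> ('k, 'a set) module" where
  "hopf_quot K F R = quot_alg (subalg F (R \<inter> derived_algebra K F)) (comm_ideal K F R)"

text \<open>
  The map of quotients induced by \<open>f\<close>, sending the coset of \<open>x\<close> to the coset \<open>f x + W\<close>. It is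
  meaningful when \<open>f\<close> maps the subspace divided out in the source into \<open>W\<close>: then the image
  below is a singleton for every coset \<open>C\<close>. The map induced by an inclusion is the case
  \<open>f = id\<close>.
\<close>

definition quot_map :: "('k, 'b) module \<Rightarrow> 'b set \<Rightarrow> ('a \<Rightarrow> 'b) \<Rightarrow> 'a set \<Rightarrow> 'b set" where
  "quot_map B W f C = the_elem ((\<lambda>x. W +>\<^bsub>B\<^esub> f x) ` C)"

text \<open>
  The map \<open>A' \<rightarrow> B'\<close> corresponding to \<open>f : A \<rightarrow> B\<close> under the identifications
  \<open>\<alpha> : A \<cong> A'\<close> and \<open>\<beta> : B \<cong> B'\<close>.
\<close>

definition transport_map ::
    "('k, 'a) module \<Rightarrow> ('a \<Rightarrow> 'c) \<Rightarrow> ('b \<Rightarrow> 'd) \<Rightarrow> ('a \<Rightarrow> 'b) \<Rightarrow> 'c \<Rightarrow> 'd" where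
  "transport_map A \<alpha> \<beta> f = \<beta> \<circ> f \<circ> inv_into (carrier A) \<alpha>"

definition exact_at ::
    "'k ring \<Rightarrow> ('k, 'a) module \<Rightarrow> ('a \<Rightarrow> 'b) \<Rightarrow> ('k, 'b) module \<Rightarrow> ('b \<Rightarrow> 'c) \<Rightarrow>
     ('k, 'c) module \<Rightarrow> bool" where
  "exact_at K A f B g C \<longleftrightarrow>
    f \<in> leibniz_hom K A B \<and> g \<in> leibniz_hom K B C \<and> f ` carrier A = a_kernel B C g"

end

theory Submission
  imports Defs
begin

text \<open>
  Every term of the sequence is a quotient of an ideal of \<open>F\<close>, and all maps are induced by
  inclusions, so exactness at each place is an equation between ideals of \<open>F\<close> such as
  \<open>T \<inter> (R + F') = R + (T \<inter> F')\<close>.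

  For \<open>M(L) \<cong> (R \<inter> F') / (FR + RF)\<close>, take a maximal defining pair \<open>(C, M)\<close> and lift \<open>F \<rightarrow> L\<close> to
  \<open>h : F \<rightarrow> C\<close>. As \<open>M\<close> is central and contained in \<open>C'\<close>, \<open>h\<close> is onto and \<open>M = h (R \<inter> F')\<close>. If
  the kernel \<open>W\<close> of \<open>h\<close> contained some \<open>v \<in> F'\<close> outside \<open>FR + RF\<close>, choose a hyperplane \<open>P\<close> of
  \<open>F\<close> that contains \<open>FR + RF\<close> but not \<open>v\<close>: then \<open>F / (W \<inter> P)\<close> belongs to a defining pair of
  dimension \<open>dim C + 1\<close>.
\<close>

section \<open>Subspaces and cosets\<close>

text \<open>Why the larger pair exists: \<open>P\<close> contains \<open>FR + RF\<close>, so
  \<open>R\<close> stays central modulo \<open>W \<inter> P\<close>; and \<open>v\<close> lies in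
  \<open>F'\<close>, so a multiple of \<open>v\<close> split off from an element of \<open>W\<close>
  can be moved into \<open>F'\<close>, which keeps \<open>R\<close> inside
  \<open>(W \<inter> P) + F'\<close>. The additional dimension is the class of \<open>v\<close>,
  killed by the projection \<open>F / (W \<inter> P) \<rightarrow> F / W \<cong> C\<close>; this
  contradicts the maximality of \<open>dim C\<close>. The obstacle is one of types. Freeness tests
  targets on \<open>'f list \<Rightarrow> 'k\<close>, maximality tests competitors on
  \<open>nat \<Rightarrow> 'k\<close>, while \<open>C\<close> lives on an arbitrary type. Algebras
  are therefore moved between types by functions with prescribed fibres; for \<open>C\<close> such
  functions exist because its dimension is finite. For the same reason epimorphisms are described by
  their fibres: two of them with the same fibres have isomorphic targets, whatever records carry
  these.\<close>

lemma (in vectorspace) subspaceI: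
  assumes "S \<subseteq> carrier V" "\<zero>\<^bsub>V\<^esub> \<in> S"
    and "\<And>x y. x \<in> S \<Longrightarrow> y \<in> S \<Longrightarrow> x \<oplus>\<^bsub>V\<^esub> y \<in> S"
    and "\<And>a x. a \<in> carrier K \<Longrightarrow> x \<in> S \<Longrightarrow> a \<odot>\<^bsub>V\<^esub> x \<in> S"
  shows "subspace K S V"
  by (intro subspace.intro submodule.intro assms vectorspace_axioms module_axioms)

lemma subspaceD:
  assumes "subspace K S V"
  shows "S \<subseteq> carrier V" "\<zero>\<^bsub>V\<^esub> \<in> S"
    and "\<And>x y. x \<in> S \<Longrightarrow> y \<in> S \<Longrightarrow> x \<oplus>\<^bsub>V\<^esub> y \<in> S"
    and "\<And>a x. a \<in> carrier K \<Longrightarrow> x \<in> S \<Longrightarrow> a \<odot>\<^bsub>V\<^esub> x \<in> S"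
  using assms by (auto simp: subspace_def submodule_def)

lemma subspace_minus:
  assumes "subspace K S V" "x \<in> S"
  shows "\<ominus>\<^bsub>V\<^esub> x \<in> S"
proof -
  interpret vectorspace K V using assms by (simp add: subspace_def)
  have "\<ominus>\<^bsub>V\<^esub> x = (\<ominus>\<^bsub>K\<^esub> \<one>\<^bsub>K\<^esub>) \<odot>\<^bsub>V\<^esub> x"
    using subspaceD[OF assms(1)] assms by (subst smult_minus_1) auto
  then show ?thesis using subspaceD[OF assms(1)] assms by auto
qed

lemma (in vectorspace) subspace_cancel:
  assumes "subspace K S V" "x \<in> S" "y \<in> carrier V"
  shows "x \<oplus>\<^bsub>V\<^esub> y \<in> S \<longleftrightarrow> y \<in> S" "y \<oplus>\<^bsub>V\<^esub> x \<in> S \<longleftrightarrow> y \<in> S"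
proof -
  note S = subspaceD[OF assms(1)]
  have x: "x \<in> carrier V" using assms S by auto
  have "y = \<ominus>\<^bsub>V\<^esub> x \<oplus>\<^bsub>V\<^esub> (x \<oplus>\<^bsub>V\<^esub> y)"
    using assms x by (simp add: M.r_neg1)
  then show "x \<oplus>\<^bsub>V\<^esub> y \<in> S \<longleftrightarrow> y \<in> S"
    using S subspace_minus[OF assms(1,2)] assms by metis
  then show "y \<oplus>\<^bsub>V\<^esub> x \<in> S \<longleftrightarrow> y \<in> S"
    using M.a_comm x assms by metis
qed

lemma (in vectorspace) subspace_Int:
  "subspace K S V \<Longrightarrow> subspace K T V \<Longrightarrow> subspace K (S \<inter> T) V"
  by (rule subspaceI) (auto dest: subspaceD)

lemma in_set_add: "x \<in> S <+>\<^bsub>V\<^esub> T \<longleftrightarrow> (\<exists>s\<in>S. \<exists>t\<in>T. x = s \<oplus>\<^bsub>V\<^esub> t)"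
  by (auto simp: set_add_def')

lemma in_a_r_coset: "x \<in> I +>\<^bsub>V\<^esub> y \<longleftrightarrow> (\<exists>i\<in>I. x = i \<oplus>\<^bsub>V\<^esub> y)"
  by (auto simp: a_r_coset_def')

lemma (in vectorspace) subspace_set_add:
  assumes "subspace K S V" "subspace K T V"
  shows "subspace K (S <+>\<^bsub>V\<^esub> T) V"
proof -
  have "S <+>\<^bsub>V\<^esub> T = submodule_sum S T"
    unfolding submodule_sum_def by (intro Set.set_eqI) (force simp: in_set_add)
  then show ?thesis using sum_is_subspace[OF assms] by simp
qed

lemma (in vectorspace) subset_set_add:
  assumes "subspace K S V" "subspace K T V"
  shows "S \<subseteq> S <+>\<^bsub>V\<^esub> T" "T \<subseteq> S <+>\<^bsub>V\<^esub> T"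
proof -
  note S = subspaceD[OF assms(1)] and T = subspaceD[OF assms(2)]
  show "S \<subseteq> S <+>\<^bsub>V\<^esub> T" 
    using S(1) T(2) unfolding in_set_add subset_iff by (metis M.r_zero)
  show "T \<subseteq> S <+>\<^bsub>V\<^esub> T" 
    using S(2) T(1) unfolding in_set_add subset_iff by (metis M.l_zero)
qed

lemma set_add_subset:
  assumes "subspace K U V" "S \<subseteq> U" "T \<subseteq> U"
  shows "S <+>\<^bsub>V\<^esub> T \<subseteq> U"
  using assms subspaceD(3)[OF assms(1)] by (auto simp: in_set_add subset_iff)

lemma (in vectorspace) span_subset_subspace:
  "subspace K U V \<Longrightarrow> S \<subseteq> U \<Longrightarrow> span S \<subseteq> U"
  by (intro span_is_subset) auto

text \<open>With the next two lemmas, \<open>x \<in> I +> y\<close> becomes an equivalence relation.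
  Congruence modulo \<open>I\<close> is kept in this form because fibres of quotient maps are
  compared through it.\<close>

lemma (in vectorspace) mem_coset_sym:
  assumes "subspace K I V" "x \<in> I +>\<^bsub>V\<^esub> y" "y \<in> carrier V"
  shows "y \<in> I +>\<^bsub>V\<^esub> x"
proof -
  obtain i where i: "i \<in> I" "x = i \<oplus>\<^bsub>V\<^esub> y" using assms by (auto simp: in_a_r_coset)
  have "i \<in> carrier V" using i(1) subspaceD(1)[OF assms(1)] by auto
  then have "y = \<ominus>\<^bsub>V\<^esub> i \<oplus>\<^bsub>V\<^esub> x"
    using assms(3) unfolding i(2) by (simp only: M.r_neg1)
  then show ?thesis using subspace_minus[OF assms(1) i(1)] unfolding in_a_r_coset by blast
qed

lemma (in vectorspace) mem_coset_trans:
  assumes "subspace K I V" "x \<in> I +>\<^bsub>V\<^esub> y" "y \<in> I +>\<^bsub>V\<^esub> z" "z \<in> carrier V"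
  shows "x \<in> I +>\<^bsub>V\<^esub> z"
proof -
  obtain i j where i: "i \<in> I" "x = i \<oplus>\<^bsub>V\<^esub> y" "j \<in> I" "y = j \<oplus>\<^bsub>V\<^esub> z" 
    using assms by (auto simp: in_a_r_coset)
  then have "x = (i \<oplus>\<^bsub>V\<^esub> j) \<oplus>\<^bsub>V\<^esub> z"
    using assms(4) subspaceD(1)[OF assms(1)] by (simp add: M.a_assoc subset_iff)
  then show ?thesis using subspaceD(3)[OF assms(1) i(1,3)] unfolding in_a_r_coset by blast
qed

lemma (in vectorspace) mem_coset_self:
  "subspace K I V \<Longrightarrow> x \<in> carrier V \<Longrightarrow> x \<in> I +>\<^bsub>V\<^esub> x"
  unfolding in_a_r_coset by (rule bexI[of _ "\<zero>\<^bsub>V\<^esub>"]) (simp_all add: subspaceD(2))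

lemma (in vectorspace) coset_eq_iff:
  assumes "subspace K I V" "x \<in> carrier V" "y \<in> carrier V"
  shows "I +>\<^bsub>V\<^esub> x = I +>\<^bsub>V\<^esub> y \<longleftrightarrow> x \<in> I +>\<^bsub>V\<^esub> y"
proof
  show "I +>\<^bsub>V\<^esub> x = I +>\<^bsub>V\<^esub> y \<Longrightarrow> x \<in> I +>\<^bsub>V\<^esub> y"
    using mem_coset_self[OF assms(1,2)] by simp
  assume *: "x \<in> I +>\<^bsub>V\<^esub> y"
  show "I +>\<^bsub>V\<^esub> x = I +>\<^bsub>V\<^esub> y"
    using mem_coset_trans[OF assms(1) _ * assms(3)]
      mem_coset_trans[OF assms(1) _ mem_coset_sym[OF assms(1) * assms(3)] assms(2)] by auto
qed

lemma (in vectorspace) coset_zero: "subspace K I V \<Longrightarrow> I +>\<^bsub>V\<^esub> \<zero>\<^bsub>V\<^esub> = I"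
  by (rule a_coset_add_zero) (rule subspaceD(1))

lemma (in vectorspace) mem_coset_zero: "subspace K I V \<Longrightarrow> x \<in> I +>\<^bsub>V\<^esub> \<zero>\<^bsub>V\<^esub> \<longleftrightarrow> x \<in> I"
  by (simp add: coset_zero)

section \<open>Homomorphisms and quotients\<close>

lemma leibniz_homD:
  assumes "h \<in> leibniz_hom K A B"
  shows "x \<in> carrier A \<Longrightarrow> h x \<in> carrier B"
    and "x \<in> carrier A \<Longrightarrow> y \<in> carrier A \<Longrightarrow> h (x \<oplus>\<^bsub>A\<^esub> y) = h x \<oplus>\<^bsub>B\<^esub> h y"
    and "x \<in> carrier A \<Longrightarrow> y \<in> carrier A \<Longrightarrow> h (x \<otimes>\<^bsub>A\<^esub> y) = h x \<otimes>\<^bsub>B\<^esub> h y"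
    and "a \<in> carrier K \<Longrightarrow> x \<in> carrier A \<Longrightarrow> h (a \<odot>\<^bsub>A\<^esub> x) = a \<odot>\<^bsub>B\<^esub> h x"
  using assms by (auto simp: leibniz_hom_def module_hom_def)

lemma leibniz_homI:
  assumes "\<And>x. x \<in> carrier A \<Longrightarrow> h x \<in> carrier B"
    and "\<And>x y. x \<in> carrier A \<Longrightarrow> y \<in> carrier A \<Longrightarrow> h (x \<oplus>\<^bsub>A\<^esub> y) = h x \<oplus>\<^bsub>B\<^esub> h y"
    and "\<And>x y. x \<in> carrier A \<Longrightarrow> y \<in> carrier A \<Longrightarrow> h (x \<otimes>\<^bsub>A\<^esub> y) = h x \<otimes>\<^bsub>B\<^esub> h y"
    and "\<And>a x. a \<in> carrier K \<Longrightarrow> x \<in> carrier A \<Longrightarrow> h (a \<odot>\<^bsub>A\<^esub> x) = a \<odot>\<^bsub>B\<^esub> h x"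
  shows "h \<in> leibniz_hom K A B"
  using assms by (auto simp: leibniz_hom_def module_hom_def)

lemma leibniz_hom_comp:
  assumes "f \<in> leibniz_hom K A B" "g \<in> leibniz_hom K B C"
  shows "(\<lambda>x. g (f x)) \<in> leibniz_hom K A C"
  by (rule leibniz_homI) (auto simp: leibniz_homD[OF assms(1)] leibniz_homD[OF assms(2)])

lemma leibniz_hom_linear_map:
  assumes "leibniz_algebra K A" "leibniz_algebra K B" "h \<in> leibniz_hom K A B"
  shows "linear_map K A B h"
proof -
  interpret A: leibniz_algebra K A by fact
  interpret B: leibniz_algebra K B by fact
  show ?thesis using assms(3)
    by (intro linear_map.intro mod_hom.intro mod_hom_axioms.intro A.vectorspace_axioms
        B.vectorspace_axioms A.module_axioms B.module_axioms) (simp add: leibniz_hom_def)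
qed

lemma subspace_image:
  assumes "leibniz_algebra K A" "leibniz_algebra K B" "h \<in> leibniz_hom K A B" "subspace K S A"
  shows "subspace K (h ` S) B"
proof -
  interpret A: leibniz_algebra K A by fact
  interpret B: leibniz_algebra K B by fact
  interpret linear_map K A B h by (rule leibniz_hom_linear_map) fact+
  note S = subspaceD[OF assms(4)] and h = leibniz_homD[OF assms(3)]
  show ?thesis
  proof (rule B.subspaceI)
    show "h ` S \<subseteq> carrier B" using S h by auto
    show "\<zero>\<^bsub>B\<^esub> \<in> h ` S" using S(2) f0_is_0 by (metis imageI)
    show "x \<oplus>\<^bsub>B\<^esub> y \<in> h ` S" if xy: "x \<in> h ` S" "y \<in> h ` S" for x y
    proof -
      obtain s t where "s \<in> S" "t \<in> S" "x = h s" "y = h t" using xy by auto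
      then show ?thesis using S(1,3) h(2)[of s t] by (metis image_eqI subsetD)
    qed
    show "a \<odot>\<^bsub>B\<^esub> x \<in> h ` S" if ax: "a \<in> carrier K" "x \<in> h ` S" for a x
    proof -
      obtain s where "s \<in> S" "x = h s" using ax by auto
      then show ?thesis using S(1,4) h(4)[of a s] ax(1) by (metis image_eqI subsetD)
    qed
  qed
qed

lemma subspace_preimage:
  assumes "leibniz_algebra K A" "leibniz_algebra K B" "h \<in> leibniz_hom K A B" "subspace K U B"
  shows "subspace K {x \<in> carrier A. h x \<in> U} A"
proof -
  interpret A: leibniz_algebra K A by fact
  interpret B: leibniz_algebra K B by fact
  interpret linear_map K A B h by (rule leibniz_hom_linear_map) fact+
  show ?thesis
    using subspaceD[OF assms(4)] leibniz_homD[OF assms(3)] f0_is_0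
    by (intro A.subspaceI) auto
qed

text \<open>Serves the uniqueness side of freeness: an equalizer that contains the generators and is
  closed under products is the whole algebra.\<close>

lemma subspace_equalizer:
  assumes "leibniz_algebra K A" "leibniz_algebra K B" "g \<in> leibniz_hom K A B" "h \<in> leibniz_hom K A B"
  shows "subspace K {x \<in> carrier A. g x = h x} A"
proof -
  interpret A: leibniz_algebra K A by fact
  interpret B: leibniz_algebra K B by fact
  interpret g: linear_map K A B g by (rule leibniz_hom_linear_map) fact+
  interpret h: linear_map K A B h by (rule leibniz_hom_linear_map) fact+
  show ?thesis
    by (intro A.subspaceI) auto
qed

text \<open>
  The kernel \<open>I\<close> is described through the fibres of \<open>p\<close>, because the zero of \<open>B\<close> need not be
  related to the other operations when \<open>B\<close> is an arbitrary record.
\<close>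

definition leibniz_epi ::
    "'k ring \<Rightarrow> ('k, 'a) module \<Rightarrow> ('k, 'b) module \<Rightarrow> 'a set \<Rightarrow> ('a \<Rightarrow> 'b) \<Rightarrow> bool" where
  "leibniz_epi K A B I p \<longleftrightarrow> p \<in> leibniz_hom K A B \<and> p ` carrier A = carrier B \<and>
    (\<forall>x\<in>carrier A. \<forall>y\<in>carrier A. p x = p y \<longleftrightarrow> x \<in> I +>\<^bsub>A\<^esub> y)"

text \<open>Every axiom but one is an equation and passes along a surjection that respects the
  operations; negatives in \<open>B\<close> are images of negatives in \<open>A\<close>. The record
  \<open>B\<close> may carry any \<open>zero\<close>, hence the last premise.\<close>

lemma leibniz_algebra_image:
  assumes "leibniz_algebra K A" "p \<in> leibniz_hom K A B" "p ` carrier A = carrier B"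
    and "p \<zero>\<^bsub>A\<^esub> = \<zero>\<^bsub>B\<^esub>"
  shows "leibniz_algebra K B"
proof -
  interpret A: leibniz_algebra K A by fact
  \<comment> \<open>The laws are oriented towards \<open>A\<close>: each term over \<open>B\<close>
    collapses to \<open>p\<close> of one term over \<open>A\<close>, where the axiom is
    available.\<close>
  note [simp] = leibniz_homD(2-4)[OF assms(2), symmetric] 
  have [simp]: "\<zero>\<^bsub>B\<^esub> = p \<zero>\<^bsub>A\<^esub>" using assms by simp
  have "module K B"
  proof (rule module_criteria, goal_cases)
    case 1 show ?case by (rule A.R.is_cring)
  next
    case 4
    show ?case
    proof
      fix v assume "v \<in> carrier B"
      then obtain x where x: "x \<in> carrier A" "v = p x" using assms(3) by blast
      then have "v \<oplus>\<^bsub>B\<^esub> p (\<ominus>\<^bsub>A\<^esub> x) = \<zero>\<^bsub>B\<^esub>" by (simp add: A.M.r_neg)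
      then show "\<exists>w\<in>carrier B. v \<oplus>\<^bsub>B\<^esub> w = \<zero>\<^bsub>B\<^esub>" using x assms(3)
        by (metis A.M.a_inv_closed imageI)
    qed
  qed (auto simp: assms(3)[symmetric] A.M.a_ac A.smult_assoc1 A.smult_l_distr A.smult_r_distr)
  then interpret vectorspace K B by (intro vectorspace.intro A.field_axioms)
  show ?thesis
    by unfold_locales
     (auto simp: assms(3)[symmetric] A.prod_closed A.prod_add_left A.prod_add_right
       A.prod_smult_left A.prod_smult_right A.leibniz[symmetric])
qed


section \<open>Subalgebras and arithmetic of cosets\<close>

lemma subalg_simps [simp]:
  "carrier (subalg A S) = S" "\<zero>\<^bsub>subalg A S\<^esub> = \<zero>\<^bsub>A\<^esub>"
  "x \<oplus>\<^bsub>subalg A S\<^esub> y = x \<oplus>\<^bsub>A\<^esub> y" "x \<otimes>\<^bsub>subalg A S\<^esub> y = x \<otimes>\<^bsub>A\<^esub> y"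
  "a \<odot>\<^bsub>subalg A S\<^esub> x = a \<odot>\<^bsub>A\<^esub> x"
  by (simp_all add: subalg_def)

lemma subalg_coset [simp]: "I +>\<^bsub>subalg A S\<^esub> x = I +>\<^bsub>A\<^esub> x"
  by (simp add: a_r_coset_def')

lemma subalg_carrier [simp]: "subalg A (carrier A) = A"
  by (simp add: subalg_def)

lemma leibniz_algebra_subalg:
  assumes "leibniz_algebra K A" "subspace K S A"
    and "\<And>x y. x \<in> S \<Longrightarrow> y \<in> S \<Longrightarrow> x \<otimes>\<^bsub>A\<^esub> y \<in> S"
  shows "leibniz_algebra K (subalg A S)"
proof -
  interpret A: leibniz_algebra K A by fact
  interpret S: vectorspace K "subalg A S"
    unfolding subalg_def by (rule A.subspace_is_vs) fact
  have "x \<in> S \<Longrightarrow> x \<in> carrier A" for x using subspaceD(1)[OF assms(2)] by auto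
  then show ?thesis
    by unfold_locales (simp_all add: assms(3) A.prod_add_left A.prod_add_right
       A.prod_smult_left A.prod_smult_right A.leibniz[symmetric])
qed

lemma subspace_subalg:
  assumes "leibniz_algebra K (subalg A S)" "subspace K I A" "I \<subseteq> S"
  shows "subspace K I (subalg A S)"
proof -
  interpret leibniz_algebra K "subalg A S" by fact
  show ?thesis by (rule subspaceI) (use assms(3) subspaceD[OF assms(2)] in auto)
qed

lemma leibniz_idealD:
  assumes "leibniz_ideal K I A"
  shows "subspace K I A" "x \<in> carrier A \<Longrightarrow> i \<in> I \<Longrightarrow> x \<otimes>\<^bsub>A\<^esub> i \<in> I"
    "x \<in> carrier A \<Longrightarrow> i \<in> I \<Longrightarrow> i \<otimes>\<^bsub>A\<^esub> x \<in> I" "I \<subseteq> carrier A"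
  using assms subspaceD(1) unfolding leibniz_ideal_def by blast+

lemma leibniz_coset_prod:
  assumes "leibniz_algebra K L" "leibniz_ideal K I L" "x \<in> I +>\<^bsub>L\<^esub> x'" "y \<in> I +>\<^bsub>L\<^esub> y'" "x' \<in> carrier L" "y' \<in> carrier L"
  shows "x \<otimes>\<^bsub>L\<^esub> y \<in> I +>\<^bsub>L\<^esub> (x' \<otimes>\<^bsub>L\<^esub> y')"
proof -
  interpret leibniz_algebra K L by fact
  note I = leibniz_idealD[OF assms(2)]
  obtain i j where ij: "i \<in> I" "j \<in> I" "x = i \<oplus>\<^bsub>L\<^esub> x'" "y = j \<oplus>\<^bsub>L\<^esub> y'"
    using assms(3,4) unfolding in_a_r_coset by auto
  have ijc: "i \<in> carrier L" "j \<in> carrier L" using ij I(4) by auto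
  have y: "y \<in> carrier L" using ijc ij assms(6) by simp
  \<comment> \<open>The first factor is split while the second stays whole, so only two correction
    terms arise, \<open>i y\<close> and \<open>x' j\<close>, both in \<open>I\<close>.\<close>
  have "x \<otimes>\<^bsub>L\<^esub> y = (i \<otimes>\<^bsub>L\<^esub> y \<oplus>\<^bsub>L\<^esub> x' \<otimes>\<^bsub>L\<^esub> j) \<oplus>\<^bsub>L\<^esub> (x' \<otimes>\<^bsub>L\<^esub> y')"
    using ijc assms(5,6) y unfolding ij(3)
    by (simp add: prod_add_left M.a_assoc prod_closed) (simp add: ij(4) prod_add_right)
  moreover have "i \<otimes>\<^bsub>L\<^esub> y \<oplus>\<^bsub>L\<^esub> x' \<otimes>\<^bsub>L\<^esub> j \<in> I"
    using I(2)[OF assms(5) ij(2)] I(3)[OF y ij(1)] subspaceD(3)[OF I(1)] by blast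
  ultimately show ?thesis unfolding in_a_r_coset by blast
qed

lemma (in vectorspace) coset_add:
  assumes "subspace K I V" "x \<in> I +>\<^bsub>V\<^esub> x'" "y \<in> I +>\<^bsub>V\<^esub> y'" "x' \<in> carrier V" "y' \<in> carrier V"
  shows "x \<oplus>\<^bsub>V\<^esub> y \<in> I +>\<^bsub>V\<^esub> (x' \<oplus>\<^bsub>V\<^esub> y')"
proof -
  obtain i j where ij: "i \<in> I" "j \<in> I" "x = i \<oplus>\<^bsub>V\<^esub> x'" "y = j \<oplus>\<^bsub>V\<^esub> y'"
    using assms(2,3) unfolding in_a_r_coset by auto
  have "i \<in> carrier V" "j \<in> carrier V" using ij subspaceD(1)[OF assms(1)] by auto
  then have "x \<oplus>\<^bsub>V\<^esub> y = (i \<oplus>\<^bsub>V\<^esub> j) \<oplus>\<^bsub>V\<^esub> (x' \<oplus>\<^bsub>V\<^esub> y')"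
    using assms(4,5) by (simp add: ij M.a_ac)
  then show ?thesis using subspaceD(3)[OF assms(1) ij(1,2)] unfolding in_a_r_coset by blast
qed

lemma (in vectorspace) coset_smult:
  assumes "subspace K I V" "x \<in> I +>\<^bsub>V\<^esub> x'" "x' \<in> carrier V" "a \<in> carrier K"
  shows "a \<odot>\<^bsub>V\<^esub> x \<in> I +>\<^bsub>V\<^esub> (a \<odot>\<^bsub>V\<^esub> x')"
proof -
  obtain i where i: "i \<in> I" "x = i \<oplus>\<^bsub>V\<^esub> x'"
    using assms(2) unfolding in_a_r_coset by auto
  have "i \<in> carrier V" using i subspaceD(1)[OF assms(1)] by auto
  then have "a \<odot>\<^bsub>V\<^esub> x = a \<odot>\<^bsub>V\<^esub> i \<oplus>\<^bsub>V\<^esub> a \<odot>\<^bsub>V\<^esub> x'"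
    using assms(3,4) by (simp add: i smult_r_distr)
  then show ?thesis using subspaceD(4)[OF assms(1,4) i(1)] unfolding in_a_r_coset by blast
qed

lemma (in vectorspace) coset_closed:
  "subspace K I V \<Longrightarrow> y \<in> carrier V \<Longrightarrow> x \<in> I +>\<^bsub>V\<^esub> y \<Longrightarrow> x \<in> carrier V"
  unfolding in_a_r_coset by (auto dest!: subspaceD(1))

text \<open>Products and scalar multiples in \<open>quot_alg\<close> are unions of cosets over all
  representatives. Independence of the representatives makes these families constant.\<close>

lemma UN_eq_constant: "x \<in> A \<Longrightarrow> (\<And>y. y \<in> A \<Longrightarrow> f y = c) \<Longrightarrow> (\<Union>y\<in>A. f y) = c"
  by auto

section \<open>Quotient algebras\<close>

lemma quot_alg_simps [simp]:
  "carrier (quot_alg A I) = (\<lambda>x. I +>\<^bsub>A\<^esub> x) ` carrier A" "\<zero>\<^bsub>quot_alg A I\<^esub> = I"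
  by (auto simp: quot_alg_def A_RCOSETS_def')

lemma leibniz_epi_quot:
  assumes "leibniz_algebra K A" "leibniz_ideal K I A"
  shows "leibniz_epi K A (quot_alg A I) I (\<lambda>x. I +>\<^bsub>A\<^esub> x)"
proof -
  interpret A: leibniz_algebra K A by fact
  note I = leibniz_idealD[OF assms(2)]
  have "(\<lambda>x. I +>\<^bsub>A\<^esub> x) \<in> leibniz_hom K A (quot_alg A I)"
  proof (rule leibniz_homI)
    fix x y assume xy: "x \<in> carrier A" "y \<in> carrier A"
    show "I +>\<^bsub>A\<^esub> (x \<oplus>\<^bsub>A\<^esub> y) = (I +>\<^bsub>A\<^esub> x) \<oplus>\<^bsub>quot_alg A I\<^esub> (I +>\<^bsub>A\<^esub> y)"
    proof (rule Set.set_eqI)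
      fix z
      have "z \<in> I +>\<^bsub>A\<^esub> (x \<oplus>\<^bsub>A\<^esub> y) \<Longrightarrow> \<exists>s\<in>I +>\<^bsub>A\<^esub> x. \<exists>t\<in>I +>\<^bsub>A\<^esub> y. z = s \<oplus>\<^bsub>A\<^esub> t"
      proof -
        assume "z \<in> I +>\<^bsub>A\<^esub> (x \<oplus>\<^bsub>A\<^esub> y)"
        then obtain i where i: "i \<in> I" "z = i \<oplus>\<^bsub>A\<^esub> (x \<oplus>\<^bsub>A\<^esub> y)" by (auto simp: in_a_r_coset)
        then have "z = (i \<oplus>\<^bsub>A\<^esub> x) \<oplus>\<^bsub>A\<^esub> y" using xy I(4) by (simp add: A.M.a_assoc subset_iff)
        moreover have "i \<oplus>\<^bsub>A\<^esub> x \<in> I +>\<^bsub>A\<^esub> x" using i by (auto simp: in_a_r_coset)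
        ultimately show ?thesis using A.mem_coset_self[OF I(1) xy(2)] by blast
      qed
      moreover have "s \<in> I +>\<^bsub>A\<^esub> x \<Longrightarrow> t \<in> I +>\<^bsub>A\<^esub> y \<Longrightarrow> s \<oplus>\<^bsub>A\<^esub> t \<in> I +>\<^bsub>A\<^esub> (x \<oplus>\<^bsub>A\<^esub> y)" for s t
        using A.coset_add[OF I(1)] xy by simp
      ultimately show "z \<in> I +>\<^bsub>A\<^esub> (x \<oplus>\<^bsub>A\<^esub> y) \<longleftrightarrow> z \<in> (I +>\<^bsub>A\<^esub> x) \<oplus>\<^bsub>quot_alg A I\<^esub> (I +>\<^bsub>A\<^esub> y)"
        unfolding quot_alg_def by (simp add: in_set_add) blast
    qed
    show "I +>\<^bsub>A\<^esub> (x \<otimes>\<^bsub>A\<^esub> y) = (I +>\<^bsub>A\<^esub> x) \<otimes>\<^bsub>quot_alg A I\<^esub> (I +>\<^bsub>A\<^esub> y)"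
      unfolding quot_alg_def rcoset_mult_def monoid.simps
    proof (rule sym, intro UN_eq_constant)
      show "x \<in> I +>\<^bsub>A\<^esub> x" "y \<in> I +>\<^bsub>A\<^esub> y" using A.mem_coset_self[OF I(1)] xy by auto
      fix s t assume st: "s \<in> I +>\<^bsub>A\<^esub> x" "t \<in> I +>\<^bsub>A\<^esub> y"
      then have "s \<in> carrier A" "t \<in> carrier A" using A.coset_closed[OF I(1)] xy by auto
      then show "I +>\<^bsub>A\<^esub> (s \<otimes>\<^bsub>A\<^esub> t) = I +>\<^bsub>A\<^esub> (x \<otimes>\<^bsub>A\<^esub> y)"
        using leibniz_coset_prod[OF assms(1,2) st xy] xy 
        by (subst A.coset_eq_iff[OF I(1)]) (auto simp: A.prod_closed)
    qed
  next
    fix a x assume ax: "a \<in> carrier K" "x \<in> carrier A"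
    show "I +>\<^bsub>A\<^esub> (a \<odot>\<^bsub>A\<^esub> x) = a \<odot>\<^bsub>quot_alg A I\<^esub> (I +>\<^bsub>A\<^esub> x)"
      unfolding quot_alg_def module.simps
    proof (rule sym, intro UN_eq_constant)
      show "x \<in> I +>\<^bsub>A\<^esub> x" using A.mem_coset_self[OF I(1)] ax by auto
      fix s assume s: "s \<in> I +>\<^bsub>A\<^esub> x"
      then have "s \<in> carrier A" using A.coset_closed[OF I(1)] ax by auto
      then show "I +>\<^bsub>A\<^esub> (a \<odot>\<^bsub>A\<^esub> s) = I +>\<^bsub>A\<^esub> (a \<odot>\<^bsub>A\<^esub> x)"
        using A.coset_smult[OF I(1) s ax(2,1)] ax
        by (subst A.coset_eq_iff[OF I(1)]) auto
    qed
  qed simp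
  then show ?thesis
    unfolding leibniz_epi_def using A.coset_eq_iff[OF I(1)] by simp
qed

lemma leibniz_epiD:
  assumes "leibniz_epi K A B I p"
  shows "p \<in> leibniz_hom K A B" "p ` carrier A = carrier B"
    "x \<in> carrier A \<Longrightarrow> y \<in> carrier A \<Longrightarrow> p x = p y \<longleftrightarrow> x \<in> I +>\<^bsub>A\<^esub> y"
  using assms unfolding leibniz_epi_def by auto

lemma leibniz_algebra_quot:
  assumes "leibniz_algebra K A" "leibniz_ideal K I A"
  shows "leibniz_algebra K (quot_alg A I)"
proof -
  interpret A: leibniz_algebra K A by fact
  note p = leibniz_epiD[OF leibniz_epi_quot[OF assms]]
  show ?thesis
    by (rule leibniz_algebra_image[OF assms(1) p(1,2)])
       (simp add: A.coset_zero[OF leibniz_idealD(1)[OF assms(2)]])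
qed

section \<open>Induced homomorphisms and the isomorphism theorems\<close>

lemma leibniz_hom_factor:
  assumes "leibniz_algebra K A" "p \<in> leibniz_hom K A B" "p ` carrier A = carrier B"
    and "q \<in> leibniz_hom K A C" and d: "\<And>x. x \<in> carrier A \<Longrightarrow> d (p x) = q x"
  shows "d \<in> leibniz_hom K B C"
proof -
  interpret A: leibniz_algebra K A by fact
  note p = leibniz_homD[OF assms(2)] and q = leibniz_homD[OF assms(4)]
  show ?thesis
    by (rule leibniz_homI)
       (auto simp: assms(3)[symmetric] p(2-4)[symmetric] d q A.prod_closed)
qed

text \<open>\<open>p\<close> and \<open>q\<close> have the same fibres, which makes \<open>d\<close>
  injective; surjectivity is inherited from \<open>q\<close>.\<close>

lemma leibniz_iso_factor:
  assumes "leibniz_algebra K A" "leibniz_epi K A B I p" "leibniz_epi K A C I q"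
    and d: "\<And>x. x \<in> carrier A \<Longrightarrow> d (p x) = q x"
  shows "d \<in> leibniz_iso K B C"
proof -
  note p = leibniz_epiD[OF assms(2)] and q = leibniz_epiD[OF assms(3)]
  have "d \<in> leibniz_hom K B C"
    by (rule leibniz_hom_factor[OF assms(1) p(1,2) q(1) d])
  moreover have "inj_on d (carrier B)"
    unfolding p(2)[symmetric] by (rule inj_onI) (use d p(3) q(3) in auto)
  moreover have "d ` carrier B = carrier C"
    unfolding p(2)[symmetric] q(2)[symmetric] image_image using d by auto
  ultimately show ?thesis by (auto simp: leibniz_iso_def bij_betw_def)
qed

text \<open>Follow a section of \<open>p\<close> by \<open>q\<close>; since the kernels agree, the
  choice of section does not matter. The isomorphisms demanded by defining pairs and by Hopf
  quotients come from here.\<close>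

lemma leibniz_epi_iso_exists:
  assumes "leibniz_algebra K A" "leibniz_epi K A B I p" "leibniz_epi K A C I q"
  shows "leibniz_iso K B C \<noteq> {}"
proof -
  note p = leibniz_epiD[OF assms(2)] and q = leibniz_epiD[OF assms(3)]
  have "q (inv_into (carrier A) p (p x)) = q x" if x: "x \<in> carrier A" for x
  proof -
    have "inv_into (carrier A) p (p x) \<in> carrier A" "p (inv_into (carrier A) p (p x)) = p x"
      using x by (auto intro: inv_into_into f_inv_into_f)
    then show ?thesis using p(3) q(3) x by simp
  qed
  then have "q \<circ> inv_into (carrier A) p \<in> leibniz_iso K B C"
    by (intro leibniz_iso_factor[OF assms]) simp
  then show ?thesis by auto
qed

lemma leibniz_epi_iso:
  assumes "leibniz_epi K A B I p" "\<phi> \<in> leibniz_iso K B C"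
  shows "leibniz_epi K A C I (\<lambda>x. \<phi> (p x))"
proof -
  note p = leibniz_epiD[OF assms(1)]
  have phi: "\<phi> \<in> leibniz_hom K B C" "inj_on \<phi> (carrier B)" "\<phi> ` carrier B = carrier C"
    using assms(2) by (auto simp: leibniz_iso_def bij_betw_def)
  have "\<phi> (p x) = \<phi> (p y) \<longleftrightarrow> x \<in> I +>\<^bsub>A\<^esub> y" if "x \<in> carrier A" "y \<in> carrier A" for x y
    using p(3)[OF that] phi(2) that p(2) by (metis imageI inj_on_eq_iff)
  then show ?thesis
    unfolding leibniz_epi_def using leibniz_hom_comp[OF p(1) phi(1)] phi(3) p(2) image_image[of \<phi> p, symmetric] by simp
qed

lemma leibniz_hom_zero:
  assumes "leibniz_algebra K A" "leibniz_algebra K B" "h \<in> leibniz_hom K A B"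
  shows "h \<zero>\<^bsub>A\<^esub> = \<zero>\<^bsub>B\<^esub>"
proof -
  interpret linear_map K A B h by (rule leibniz_hom_linear_map) fact+
  show ?thesis by simp
qed

lemma leibniz_epi_eq_zero_iff:
  assumes "leibniz_algebra K A" "leibniz_algebra K B" "leibniz_epi K A B I p" "subspace K I A"
    and "x \<in> carrier A"
  shows "p x = \<zero>\<^bsub>B\<^esub> \<longleftrightarrow> x \<in> I"
proof -
  interpret A: leibniz_algebra K A by fact
  note p = leibniz_epiD[OF assms(3)]
  have "p x = \<zero>\<^bsub>B\<^esub> \<longleftrightarrow> p x = p \<zero>\<^bsub>A\<^esub>" using leibniz_hom_zero[OF assms(1,2) p(1)] by simp
  also have "\<dots> \<longleftrightarrow> x \<in> I"
    using p(3)[OF assms(5) A.M.zero_closed] A.mem_coset_zero[OF assms(4)] by simp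
  finally show ?thesis .
qed

lemma leibniz_epi_kernelI:
  assumes "leibniz_algebra K A" "leibniz_algebra K B" "p \<in> leibniz_hom K A B"
    and "p ` carrier A = carrier B"
  shows "leibniz_epi K A B {x \<in> carrier A. p x = \<zero>\<^bsub>B\<^esub>} p"
proof -
  interpret A: leibniz_algebra K A by fact
  interpret B: leibniz_algebra K B by fact
  note p = leibniz_homD[OF assms(3)]
  have "p x = p y \<longleftrightarrow> x \<in> {x \<in> carrier A. p x = \<zero>\<^bsub>B\<^esub>} +>\<^bsub>A\<^esub> y"
    if xy: "x \<in> carrier A" "y \<in> carrier A" for x y
  proof
    assume eq: "p x = p y"
    have d: "x \<ominus>\<^bsub>A\<^esub> y \<in> carrier A" using xy by simp
    have x: "x = (x \<ominus>\<^bsub>A\<^esub> y) \<oplus>\<^bsub>A\<^esub> y" using xy by (simp add: a_minus_def A.M.a_assoc A.M.l_neg)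
    have "p (x \<ominus>\<^bsub>A\<^esub> y) \<oplus>\<^bsub>B\<^esub> p y = p y" using p(2)[OF d xy(2)] x eq by simp
    then have "p (x \<ominus>\<^bsub>A\<^esub> y) = \<zero>\<^bsub>B\<^esub>" using p(1)[OF d] p(1)[OF xy(2)] by simp
    then show "x \<in> {x \<in> carrier A. p x = \<zero>\<^bsub>B\<^esub>} +>\<^bsub>A\<^esub> y"
      unfolding in_a_r_coset using x \<open>p (x \<ominus>\<^bsub>A\<^esub> y) = \<zero>\<^bsub>B\<^esub>\<close> d by blast
  next
    assume "x \<in> {x \<in> carrier A. p x = \<zero>\<^bsub>B\<^esub>} +>\<^bsub>A\<^esub> y"
    then show "p x = p y" using xy p(1,2) unfolding in_a_r_coset by auto
  qed
  then show ?thesis unfolding leibniz_epi_def using assms(3,4) by simp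
qed

text \<open>Elements of one coset of \<open>I\<close> have images in one coset of \<open>W\<close>,
  so \<open>the_elem\<close> is applied to a singleton.\<close>

lemma quot_map_coset:
  assumes "vectorspace K A" "vectorspace K B" "subspace K I A" "subspace K W B"
    and f: "\<And>x. x \<in> carrier A \<Longrightarrow> f x \<in> carrier B"
      "\<And>x y. x \<in> carrier A \<Longrightarrow> y \<in> carrier A \<Longrightarrow> f (x \<oplus>\<^bsub>A\<^esub> y) = f x \<oplus>\<^bsub>B\<^esub> f y"
    and W: "f ` I \<subseteq> W" and x: "x \<in> carrier A"
  shows "quot_map B W f (I +>\<^bsub>A\<^esub> x) = W +>\<^bsub>B\<^esub> f x"
proof -
  interpret A: vectorspace K A by fact
  interpret B: vectorspace K B by fact
  have "W +>\<^bsub>B\<^esub> f y = W +>\<^bsub>B\<^esub> f x" if y: "y \<in> I +>\<^bsub>A\<^esub> x" for y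
  proof -
    obtain i where i: "i \<in> I" "y = i \<oplus>\<^bsub>A\<^esub> x" using y by (auto simp: in_a_r_coset)
    then have "f y = f i \<oplus>\<^bsub>B\<^esub> f x" using f(2)[of i x] x subspaceD(1)[OF assms(3)] by blast
    then have "f y \<in> W +>\<^bsub>B\<^esub> f x" using i(1) W unfolding in_a_r_coset by blast
    moreover have "y \<in> carrier A" by (rule A.coset_closed[OF assms(3) x y])
    ultimately show ?thesis using f(1) x by (simp add: B.coset_eq_iff[OF assms(4)])
  qed
  then show ?thesis
    unfolding quot_map_def using A.mem_coset_self[OF assms(3) x]
    by (intro the_elem_image_unique) blast+
qed

text \<open>Third isomorphism theorem for fibres: \<open>p x\<close> and \<open>p y\<close> are
  congruent modulo the image of \<open>S\<close> when \<open>x = (i + s) + y\<close> with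
  \<open>i\<close> in \<open>I\<close> and \<open>s\<close> in \<open>S\<close>, and
  \<open>S\<close> absorbs \<open>I\<close>.\<close>

lemma leibniz_epi_comp:
  assumes "leibniz_algebra K A" "leibniz_epi K A B I p" "leibniz_epi K B C (p ` S) r"
    and "subspace K S A" "I \<subseteq> S"
  shows "leibniz_epi K A C S (\<lambda>x. r (p x))"
proof -
  interpret A: leibniz_algebra K A by fact
  note p = leibniz_epiD[OF assms(2)] and r = leibniz_epiD[OF assms(3)]
  note S = subspaceD[OF assms(4)]
  have "r (p x) = r (p y) \<longleftrightarrow> x \<in> S +>\<^bsub>A\<^esub> y" if xy: "x \<in> carrier A" "y \<in> carrier A" for x y
  proof -
    have "r (p x) = r (p y) \<longleftrightarrow> p x \<in> p ` S +>\<^bsub>B\<^esub> p y"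
      using r(3) p(2) xy by (metis imageI)
    also have "\<dots> \<longleftrightarrow> (\<exists>s\<in>S. p x = p s \<oplus>\<^bsub>B\<^esub> p y)" by (auto simp: in_a_r_coset)
    also have "\<dots> \<longleftrightarrow> (\<exists>s\<in>S. p x = p (s \<oplus>\<^bsub>A\<^esub> y))"
    proof (rule bex_cong[OF refl])
      fix s assume "s \<in> S"
      then have "s \<in> carrier A" using S(1) by auto
      then show "p x = p s \<oplus>\<^bsub>B\<^esub> p y \<longleftrightarrow> p x = p (s \<oplus>\<^bsub>A\<^esub> y)"
        using leibniz_homD(2)[OF p(1) _ xy(2)] by simp
    qed
    also have "\<dots> \<longleftrightarrow> (\<exists>s\<in>S. \<exists>i\<in>I. x = (i \<oplus>\<^bsub>A\<^esub> s) \<oplus>\<^bsub>A\<^esub> y)"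
    proof (rule bex_cong[OF refl])
      fix s assume "s \<in> S"
      then have s: "s \<in> carrier A" using S(1) by auto
      have "p x = p (s \<oplus>\<^bsub>A\<^esub> y) \<longleftrightarrow> x \<in> I +>\<^bsub>A\<^esub> (s \<oplus>\<^bsub>A\<^esub> y)"
        using p(3) s xy by simp
      also have "\<dots> \<longleftrightarrow> (\<exists>i\<in>I. x = (i \<oplus>\<^bsub>A\<^esub> s) \<oplus>\<^bsub>A\<^esub> y)"
        unfolding in_a_r_coset
      proof (rule bex_cong[OF refl])
        fix i assume "i \<in> I"
        then have "i \<in> carrier A" using S(1) assms(5) by auto
        then show "x = i \<oplus>\<^bsub>A\<^esub> (s \<oplus>\<^bsub>A\<^esub> y) \<longleftrightarrow> x = (i \<oplus>\<^bsub>A\<^esub> s) \<oplus>\<^bsub>A\<^esub> y"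
          using s xy(2) by (simp only: A.M.a_assoc)
      qed
      finally show "p x = p (s \<oplus>\<^bsub>A\<^esub> y) \<longleftrightarrow> (\<exists>i\<in>I. x = (i \<oplus>\<^bsub>A\<^esub> s) \<oplus>\<^bsub>A\<^esub> y)" .
    qed
    also have "\<dots> \<longleftrightarrow> x \<in> S +>\<^bsub>A\<^esub> y"
    proof
      assume "\<exists>s\<in>S. \<exists>i\<in>I. x = (i \<oplus>\<^bsub>A\<^esub> s) \<oplus>\<^bsub>A\<^esub> y"
      then show "x \<in> S +>\<^bsub>A\<^esub> y" unfolding in_a_r_coset using S(3) assms(5) by blast
    next
      assume "x \<in> S +>\<^bsub>A\<^esub> y"
      then obtain s where s: "s \<in> S" "x = s \<oplus>\<^bsub>A\<^esub> y" by (auto simp: in_a_r_coset)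
      \<comment> \<open>\<open>p s = p s\<close>, read through the fibre condition, produces an
        \<open>i\<close> in \<open>I\<close> with \<open>s = i + s\<close>, that is, a zero inside
        \<open>I\<close>.\<close>
      obtain i where i: "i \<in> I" "s = i \<oplus>\<^bsub>A\<^esub> s"
        using p(3)[of s s] s(1) S(1) unfolding in_a_r_coset by blast
      then show "\<exists>s\<in>S. \<exists>i\<in>I. x = (i \<oplus>\<^bsub>A\<^esub> s) \<oplus>\<^bsub>A\<^esub> y" using s by (metis (no_types))
    qed
    finally show ?thesis .
  qed
  then show ?thesis unfolding leibniz_epi_def 
    using leibniz_hom_comp[OF p(1) r(1)] p(2) r(2) image_image[of r p, symmetric] by simp
qed

section \<open>Ideals and products\<close>

lemma leibniz_hom_subalg:
  "h \<in> leibniz_hom K (subalg F S) B \<Longrightarrow> U \<subseteq> S \<Longrightarrow> h \<in> leibniz_hom K (subalg F U) B"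
  using leibniz_homD[of h K "subalg F S" B] by (intro leibniz_homI) (simp_all add: subset_iff)

lemma leibniz_ideal_Int:
  assumes "leibniz_ideal K I A" "leibniz_ideal K J A"
  shows "leibniz_ideal K (I \<inter> J) A"
proof -
  interpret vectorspace K A using assms by (simp add: leibniz_ideal_def subspace_def)
  show ?thesis using assms subspace_Int unfolding leibniz_ideal_def by auto
qed

lemma leibniz_algebra_ideal:
  assumes "leibniz_algebra K A" "leibniz_ideal K S A"
  shows "leibniz_algebra K (subalg A S)"
  using leibniz_idealD[OF assms(2)] by (intro leibniz_algebra_subalg[OF assms(1)]) auto

lemma leibniz_ideal_subalg:
  assumes "leibniz_algebra K A" "leibniz_ideal K S A" "leibniz_ideal K I A" "I \<subseteq> S"
  shows "leibniz_ideal K I (subalg A S)"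
  using leibniz_idealD[OF assms(3)] leibniz_idealD(4)[OF assms(2)]
    subspace_subalg[OF leibniz_algebra_ideal[OF assms(1,2)] _ assms(4)]
  unfolding leibniz_ideal_def by auto

section \<open>Spans of products and derived algebras\<close>

lemma prod_span_subspace:
  assumes "leibniz_algebra K A" "S \<subseteq> carrier A" "T \<subseteq> carrier A"
  shows "subspace K (prod_span K A S T) A"
proof -
  interpret A: leibniz_algebra K A by fact
  show ?thesis unfolding prod_span_def
    by (rule A.span_is_subspace) (use assms A.prod_closed in blast)
qed

lemma prod_span_mem:
  assumes "leibniz_algebra K A" "S \<subseteq> carrier A" "T \<subseteq> carrier A" "x \<in> S" "y \<in> T"
  shows "x \<otimes>\<^bsub>A\<^esub> y \<in> prod_span K A S T"
proof -
  interpret A: leibniz_algebra K A by fact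
  have "{a \<otimes>\<^bsub>A\<^esub> b |a b. a \<in> S \<and> b \<in> T} \<subseteq> carrier A"
    using assms(2,3) A.prod_closed by blast
  from A.in_own_span[OF this] show ?thesis unfolding prod_span_def using assms(4,5) by blast
qed

lemma prod_span_least:
  assumes "subspace K U A" "\<And>x y. x \<in> S \<Longrightarrow> y \<in> T \<Longrightarrow> x \<otimes>\<^bsub>A\<^esub> y \<in> U"
  shows "prod_span K A S T \<subseteq> U"
proof -
  interpret vectorspace K A using assms by (simp add: subspace_def)
  show ?thesis unfolding prod_span_def
    by (rule span_subset_subspace[OF assms(1)]) (use assms(2) in blast)
qed

lemma derived_algebra_subspace:
  "leibniz_algebra K A \<Longrightarrow> subspace K (derived_algebra K A) A"
  unfolding derived_algebra_def by (rule prod_span_subspace) auto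

lemma derived_algebra_mem:
  "leibniz_algebra K A \<Longrightarrow> x \<in> carrier A \<Longrightarrow> y \<in> carrier A \<Longrightarrow> x \<otimes>\<^bsub>A\<^esub> y \<in> derived_algebra K A"
  unfolding derived_algebra_def by (rule prod_span_mem) auto

text \<open>Every product of \<open>A\<close> lies in the derived algebra, hence in
  \<open>S\<close>. This settles \<open>R + F'\<close>, \<open>T + F'\<close> and
  \<open>Z + L'\<close>.\<close>

lemma leibniz_idealI_derived:
  assumes "leibniz_algebra K A" "subspace K S A" "derived_algebra K A \<subseteq> S"
  shows "leibniz_ideal K S A"
  using assms(2,3) derived_algebra_mem[OF assms(1)] subspaceD(1)[OF assms(2)]
  unfolding leibniz_ideal_def by blast

lemma derived_algebra_ideal:
  "leibniz_algebra K A \<Longrightarrow> leibniz_ideal K (derived_algebra K A) A"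
  by (rule leibniz_idealI_derived) (auto intro: derived_algebra_subspace)

lemma derived_algebra_image:
  assumes "leibniz_algebra K A" "leibniz_algebra K B" "p \<in> leibniz_hom K A B"
    "p ` carrier A = carrier B"
  shows "p ` derived_algebra K A = derived_algebra K B"
proof
  note p = leibniz_homD[OF assms(3)]
  have "derived_algebra K A \<subseteq> {x \<in> carrier A. p x \<in> derived_algebra K B}"
    unfolding derived_algebra_def[of K A]
  proof (rule prod_span_least)
    show "subspace K {x \<in> carrier A. p x \<in> derived_algebra K B} A"
      by (rule subspace_preimage[OF assms(1-3) derived_algebra_subspace[OF assms(2)]])
    show "x \<otimes>\<^bsub>A\<^esub> y \<in> {x \<in> carrier A. p x \<in> derived_algebra K B}"
      if "x \<in> carrier A" "y \<in> carrier A" for x y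
      using that p derived_algebra_mem[OF assms(2)] leibniz_algebra.prod_closed[OF assms(1)]
      by simp
  qed
  then show "p ` derived_algebra K A \<subseteq> derived_algebra K B" by auto
  show "derived_algebra K B \<subseteq> p ` derived_algebra K A"
    unfolding derived_algebra_def[of K B]
  proof (rule prod_span_least)
    show "subspace K (p ` derived_algebra K A) B"
      by (rule subspace_image[OF assms(1-3) derived_algebra_subspace[OF assms(1)]])
    fix x y assume "x \<in> carrier B" "y \<in> carrier B"
    then obtain a b where ab: "a \<in> carrier A" "b \<in> carrier A" "x = p a" "y = p b"
      using assms(4) by (metis imageE)
    then show "x \<otimes>\<^bsub>B\<^esub> y \<in> p ` derived_algebra K A"
      using p(3)[OF ab(1,2)] derived_algebra_mem[OF assms(1) ab(1,2)] by (metis imageI)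
  qed
qed

section \<open>The ideal spanned by the products with a given ideal\<close>

lemma comm_ideal_subspace:
  assumes "leibniz_algebra K A" "I \<subseteq> carrier A"
  shows "subspace K (comm_ideal K A I) A"
proof -
  interpret A: leibniz_algebra K A by fact
  show ?thesis unfolding comm_ideal_def
    by (intro A.subspace_set_add prod_span_subspace assms) auto
qed

lemma comm_ideal_mem:
  assumes "leibniz_algebra K A" "I \<subseteq> carrier A" "x \<in> carrier A" "i \<in> I"
  shows "x \<otimes>\<^bsub>A\<^esub> i \<in> comm_ideal K A I" "i \<otimes>\<^bsub>A\<^esub> x \<in> comm_ideal K A I"
proof -
  interpret A: leibniz_algebra K A by fact
  note s = prod_span_subspace[OF assms(1) subset_refl assms(2)]
    prod_span_subspace[OF assms(1,2) subset_refl]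
  show "x \<otimes>\<^bsub>A\<^esub> i \<in> comm_ideal K A I" "i \<otimes>\<^bsub>A\<^esub> x \<in> comm_ideal K A I"
    unfolding comm_ideal_def using A.subset_set_add[OF s] 
      prod_span_mem[OF assms(1) subset_refl assms(2,3,4)]
      prod_span_mem[OF assms(1,2) subset_refl assms(4,3)] by auto
qed

lemma comm_ideal_least:
  assumes "subspace K U A" "\<And>x i. x \<in> carrier A \<Longrightarrow> i \<in> I \<Longrightarrow> x \<otimes>\<^bsub>A\<^esub> i \<in> U \<and> i \<otimes>\<^bsub>A\<^esub> x \<in> U"
  shows "comm_ideal K A I \<subseteq> U"
  unfolding comm_ideal_def using assms(2)
  by (intro set_add_subset[OF assms(1)] prod_span_least[OF assms(1)]) auto

lemma comm_ideal_subset: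
  assumes "leibniz_algebra K A" "leibniz_ideal K I A"
  shows "comm_ideal K A I \<subseteq> I" "comm_ideal K A I \<subseteq> derived_algebra K A"
proof -
  note I = leibniz_idealD[OF assms(2)]
  show "comm_ideal K A I \<subseteq> I" by (rule comm_ideal_least) (use I in auto)
  show "comm_ideal K A I \<subseteq> derived_algebra K A"
    using I(4) by (intro comm_ideal_least derived_algebra_subspace assms(1))
      (auto intro: derived_algebra_mem[OF assms(1)])
qed

text \<open>A product with an element of \<open>I\<close> already lies in
  \<open>comm_ideal K A I\<close>, so \<open>S\<close> absorbs it. This covers
  \<open>comm_ideal K A I\<close> itself and later \<open>W \<inter> P\<close>, where
  \<open>P\<close> is merely a subspace.\<close>

lemma leibniz_ideal_between:
  assumes "leibniz_algebra K A" "leibniz_ideal K I A" "subspace K S A"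
    "comm_ideal K A I \<subseteq> S" "S \<subseteq> I"
  shows "leibniz_ideal K S A"
  unfolding leibniz_ideal_def
proof (intro conjI ballI assms(3))
  fix x i assume x: "x \<in> carrier A" and "i \<in> S"
  then have "i \<in> I" using assms(5) by auto
  from comm_ideal_mem[OF assms(1) leibniz_idealD(4)[OF assms(2)] x this]
  show "x \<otimes>\<^bsub>A\<^esub> i \<in> S" "i \<otimes>\<^bsub>A\<^esub> x \<in> S"
    using assms(4) by auto
qed

lemma comm_ideal_ideal:
  assumes "leibniz_algebra K A" "leibniz_ideal K I A"
  shows "leibniz_ideal K (comm_ideal K A I) A"
  by (rule leibniz_ideal_between[OF assms comm_ideal_subspace[OF assms(1) leibniz_idealD(4)[OF assms(2)]]
        subset_refl comm_ideal_subset(1)[OF assms]])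

section \<open>Presentations by ideals and a criterion for exactness\<close>

lemma leibniz_epi_quot_subalg:
  assumes "leibniz_algebra K A" "leibniz_ideal K S A" "leibniz_ideal K I A" "I \<subseteq> S"
  shows "leibniz_epi K (subalg A S) (quot_alg (subalg A S) I) I (\<lambda>x. I +>\<^bsub>A\<^esub> x)"
  using leibniz_epi_quot[OF leibniz_algebra_ideal[OF assms(1,2)] leibniz_ideal_subalg[OF assms]]
  by simp

lemma leibniz_epi_hopf_quot:
  assumes "leibniz_algebra K A" "leibniz_ideal K I A"
  shows "leibniz_epi K (subalg A (I \<inter> derived_algebra K A)) (hopf_quot K A I) (comm_ideal K A I)
    (\<lambda>x. comm_ideal K A I +>\<^bsub>A\<^esub> x)"
  unfolding hopf_quot_def
  by (intro leibniz_epi_quot_subalg leibniz_ideal_Int derived_algebra_ideal comm_ideal_ideal assms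
      Int_greatest comm_ideal_subset)

lemma transport_map_apply:
  assumes "\<alpha> \<in> leibniz_iso K A B" "x \<in> carrier A"
  shows "transport_map A \<alpha> \<beta> f (\<alpha> x) = \<beta> (f x)"
  using assms by (simp add: transport_map_def leibniz_iso_def bij_betw_def inv_into_f_f)

text \<open>Pulled back along \<open>pB\<close>, the kernel of \<open>e\<close> is
  \<open>SB \<inter> IC\<close> and the image of \<open>d\<close> is \<open>IB + SA\<close>, whence
  the last premise. Exactness mentions only the zero of \<open>C\<close>, and the premise
  \<open>zero\<close> ties it to the fibres of \<open>pC\<close>; so \<open>A\<close> and
  \<open>B\<close> can be arbitrary records, as \<open>M\<close> and \<open>MQ\<close> are in the
  theorem.\<close>

lemma exact_atI:
  assumes alg: "leibniz_algebra K (subalg F SA)" "leibniz_algebra K (subalg F SB)"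
    and epi: "leibniz_epi K (subalg F SA) A IA pA" "leibniz_epi K (subalg F SB) B IB pB"
      "leibniz_epi K (subalg F SC) C IC pC"
    and sub: "SA \<subseteq> SB" "SB \<subseteq> SC"
    and zero: "\<And>x. x \<in> SC \<Longrightarrow> pC x = \<zero>\<^bsub>C\<^esub> \<longleftrightarrow> x \<in> IC"
    and d: "\<And>x. x \<in> SA \<Longrightarrow> d (pA x) = pB x" and e: "\<And>x. x \<in> SB \<Longrightarrow> e (pB x) = pC x"
    and exact: "SB \<inter> IC = IB <+>\<^bsub>F\<^esub> SA"
  shows "exact_at K A d B e C"
proof -
  note pA = leibniz_epiD[OF epi(1), simplified] and pB = leibniz_epiD[OF epi(2), simplified]
    and pC = leibniz_epiD[OF epi(3), simplified]
  have "d \<in> leibniz_hom K A B"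
    using d pA by (intro leibniz_hom_factor[OF alg(1) pA(1) _ leibniz_hom_subalg[OF pB(1) sub(1)]]) auto
  moreover have "e \<in> leibniz_hom K B C"
    using e pB by (intro leibniz_hom_factor[OF alg(2) pB(1) _ leibniz_hom_subalg[OF pC(1) sub(2)]]) auto
  moreover have "d ` carrier A = a_kernel B C e"
  proof
    show "d ` carrier A \<subseteq> a_kernel B C e"
    proof
      fix b assume "b \<in> d ` carrier A"
      then have "b \<in> d ` pA ` SA" by (simp only: pA(2))
      then obtain x where x: "x \<in> SA" "b = pB x" using d by auto
      have xB: "x \<in> SB" using x sub by auto
      \<comment> \<open>Reflexivity of the fibre relation again yields a neutral element in
        \<open>IB\<close>, so \<open>x\<close> belongs to \<open>IB + SA\<close>.\<close>
      have "x \<in> IB +>\<^bsub>F\<^esub> x" using pB(3)[OF xB xB] by simp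
      then have "x \<in> IC" using exact x(1) unfolding in_set_add in_a_r_coset set_eq_iff by blast
      then have "e b = \<zero>\<^bsub>C\<^esub>" using zero xB sub x e by auto
      then show "b \<in> a_kernel B C e" using xB x pB(2) by (auto simp: a_kernel_def')
    qed
    show "a_kernel B C e \<subseteq> d ` carrier A"
    proof
      fix b assume "b \<in> a_kernel B C e"
      then have "b \<in> pB ` SB" and e0: "e b = \<zero>\<^bsub>C\<^esub>"
        by (simp_all add: a_kernel_def' pB(2))
      then obtain x where x: "x \<in> SB" "b = pB x" "e b = \<zero>\<^bsub>C\<^esub>" by auto
      then have "x \<in> IC" using e zero sub by auto
      then obtain y where y: "y \<in> SA" "x \<in> IB +>\<^bsub>F\<^esub> y"
        using exact x(1) unfolding in_set_add in_a_r_coset set_eq_iff by blast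
      then have "pB x = pB y" using pB(3) x(1) sub by auto
      then show "b \<in> d ` carrier A" using d y(1) x(2) pA(2) by (metis imageI)
    qed
  qed
  ultimately show ?thesis by (simp add: exact_at_def)
qed

section \<open>The multiplier as a Hopf quotient\<close>

text \<open>Coefficients over a finite spanning set, chosen once for each vector, determine the
  vector, and an infinite index type has room for them. With \<open>'i\<close> a type of lists this
  brings \<open>C\<close> within reach of the universal property; with \<open>'i = nat\<close> it
  brings \<open>C\<close> into the type of its competitors.\<close>

lemma (in vectorspace) fin_dim_inj:
  assumes "fin_dim" "infinite (UNIV :: 'i set)"
  shows "\<exists>j :: 'c \<Rightarrow> 'i \<Rightarrow> 'a. inj_on j (carrier V)"
proof -
  obtain A where A: "finite A" "A \<subseteq> carrier V" "span A = carrier V"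
    using assms(1) unfolding fin_dim_def by auto
  obtain B :: "'i set" where "finite B" "card B = card A"
    using infinite_arbitrarily_large[OF assms(2)] by blast
  then obtain e where e: "bij_betw e A B"
    using finite_same_card_bij[OF A(1)] by metis
  have "\<forall>v. \<exists>a. v \<in> carrier V \<longrightarrow> a \<in> A \<rightarrow> carrier K \<and> lincomb a A = v"
    using finite_span[OF A(1,2)] A(3) by auto
  then obtain a where a: "\<And>v. v \<in> carrier V \<Longrightarrow> a v \<in> A \<rightarrow> carrier K"
    "\<And>v. v \<in> carrier V \<Longrightarrow> lincomb (a v) A = v" by metis
  have "inj_on (\<lambda>v i. a v (inv_into A e i)) (carrier V)"
  proof (rule inj_onI)
    fix v w assume vw: "v \<in> carrier V" "w \<in> carrier V"
      and eq: "(\<lambda>i. a v (inv_into A e i)) = (\<lambda>i. a w (inv_into A e i))"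
    \<comment> \<open>Evaluation at \<open>e x\<close> recovers the coefficient at \<open>x\<close>;
      indices outside the image of \<open>A\<close> are never consulted.\<close>
    have "a v x = a w x" if "x \<in> A" for x
      using fun_cong[OF eq, of "e x"] e that by (simp add: bij_betw_def)
    then have "lincomb (a v) A = lincomb (a w) A"
      using a(1)[OF vw(2)] A(2) by (intro lincomb_cong) auto
    then show "v = w" using a(2) vw by simp
  qed
  then show ?thesis by blast
qed

text \<open>By Steinitz exchange, \<open>u\<close> together with at most \<open>dim V - 1\<close>
  vectors spans \<open>V\<close>. \<open>T\<close> kills \<open>u\<close>, so the images of the
  other vectors span \<open>W\<close>.\<close>

lemma dim_less_of_kernel:
  assumes "vectorspace.fin_dim K V" "T ` carrier V = carrier W"
    "u \<in> carrier V" "u \<noteq> \<zero>\<^bsub>V\<^esub>" "T u = \<zero>\<^bsub>W\<^esub>" and lin: "linear_map K V W T"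
  shows "vectorspace.dim K W < vectorspace.dim K V"
proof -
  interpret V: vectorspace K V using lin by (simp add: linear_map_def)
  interpret W: vectorspace K W using lin by (simp add: linear_map_def)
  interpret linear_map K V W T by (rule lin)
  obtain B where B: "finite B" "V.basis B" using V.finite_basis_exists[OF assms(1)] by auto
  then have Bc: "B \<subseteq> carrier V" "V.span B = carrier V" "V.dim = card B"
    using V.dim_basis by (auto simp: V.basis_def)
  \<comment> \<open>The exchange lemma wants \<open>{u}\<close> independent: \<open>u\<close> is
    nonzero and so lies outside the span of the empty set.\<close>
  have "V.span {} \<subseteq> {\<zero>\<^bsub>V\<^esub>}"
    by (rule V.span_subset_subspace, rule V.subspaceI) auto
  then have "V.lin_indpt ({} \<union> {u})"
    using V.lin_dep_iff_in_span[of "{}" u] assms(3,4) by (auto simp: V.lin_dep_def)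
  then obtain C where C: "finite C" "C \<subseteq> carrier V" "int (card C) \<le> int (card B) - 1"
    "V.span ({u} \<union> C) = carrier V"
    using V.replacement[of "{u}" B] B(1) Bc(1,2) assms(3) by auto
  have TC: "T ` C \<subseteq> carrier W" using C(2) assms(2) by auto
  have "W.gen_set (T ` C)"
  proof
    show "W.span (T ` C) \<subseteq> carrier W" by (rule W.span_is_subset2[OF TC])
    have s: "subspace K (W.span (T ` C)) W" by (rule W.span_is_subspace[OF TC])
    have "subspace K {x \<in> carrier V. T x \<in> W.span (T ` C)} V"
      using subspaceD[OF s] by (intro V.subspaceI) auto
    moreover have "{u} \<union> C \<subseteq> {x \<in> carrier V. T x \<in> W.span (T ` C)}"
      using W.in_own_span[OF TC] C(2) assms(3,5) subspaceD(2)[OF s] by auto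
    ultimately have "carrier V \<subseteq> {x \<in> carrier V. T x \<in> W.span (T ` C)}"
      using V.span_subset_subspace C(4) by metis
    then show "carrier W \<subseteq> W.span (T ` C)" unfolding assms(2)[symmetric] by auto
  qed
  then have "W.dim \<le> card (T ` C)" using W.gen_ge_dim[OF _ TC] C(1) by auto
  also have "\<dots> \<le> card C" using C(1) by (rule card_image_le)
  finally show ?thesis using C(3) Bc(3) by auto
qed

text \<open>\<open>F\<close> may be infinite-dimensional, so Zorn's lemma supplies \<open>P\<close>,
  maximal among the subspaces that contain \<open>U\<close> and avoid \<open>v\<close>. The last
  conclusion says that \<open>v\<close> spans a complement of \<open>P\<close>, which is what a
  linear functional with kernel \<open>P\<close> amounts to.\<close>

lemma (in vectorspace) hyperplane_exists:
  assumes "subspace K U V" "v \<in> carrier V" "v \<notin> U"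
  obtains P where "subspace K P V" "U \<subseteq> P" "v \<notin> P"
    "\<And>x. x \<in> carrier V \<Longrightarrow> \<exists>a\<in>carrier K. x \<in> P +>\<^bsub>V\<^esub> (a \<odot>\<^bsub>V\<^esub> v)"
proof -
  let ?A = "{P. subspace K P V \<and> U \<subseteq> P \<and> v \<notin> P}"
  have "\<exists>P\<in>?A. \<forall>Q\<in>?A. P \<subseteq> Q \<longrightarrow> Q = P"
  proof (rule subset_Zorn_nonempty)
    show "?A \<noteq> {}" using assms by auto
    fix \<C> assume \<C>: "\<C> \<noteq> {}" "subset.chain ?A \<C>"
    then have sub: "\<And>Q. Q \<in> \<C> \<Longrightarrow> subspace K Q V \<and> U \<subseteq> Q \<and> v \<notin> Q"
      and lin: "\<And>Q Q'. Q \<in> \<C> \<Longrightarrow> Q' \<in> \<C> \<Longrightarrow> Q \<subseteq> Q' \<or> Q' \<subseteq> Q"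
      by (auto simp: subset_chain_def)
    have "subspace K (\<Union>\<C>) V"
    proof (rule subspaceI)
      have C: "Q \<subseteq> carrier V" "\<zero>\<^bsub>V\<^esub> \<in> Q" "x \<in> Q \<Longrightarrow> y \<in> Q \<Longrightarrow> x \<oplus>\<^bsub>V\<^esub> y \<in> Q"
        "a \<in> carrier K \<Longrightarrow> x \<in> Q \<Longrightarrow> a \<odot>\<^bsub>V\<^esub> x \<in> Q" if "Q \<in> \<C>" for Q x y a
        using subspaceD[of K Q V] sub[OF that] by simp_all
      show "\<Union>\<C> \<subseteq> carrier V" using C(1) by blast
      show "\<zero>\<^bsub>V\<^esub> \<in> \<Union>\<C>" using C(2) \<C>(1) by blast
      show "a \<odot>\<^bsub>V\<^esub> x \<in> \<Union>\<C>" if "a \<in> carrier K" "x \<in> \<Union>\<C>" for a x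
        using that C(4) by (metis UnionE UnionI)
      fix x y assume "x \<in> \<Union>\<C>" "y \<in> \<Union>\<C>"
      then obtain Q Q' where Q: "Q \<in> \<C>" "Q' \<in> \<C>" "x \<in> Q" "y \<in> Q'" by auto
      then have "x \<oplus>\<^bsub>V\<^esub> y \<in> Q \<or> x \<oplus>\<^bsub>V\<^esub> y \<in> Q'"
        using lin[OF Q(1,2)] C(3)[OF Q(1)] C(3)[OF Q(2)] by (metis subsetD)
      then show "x \<oplus>\<^bsub>V\<^esub> y \<in> \<Union>\<C>" using Q by auto
    qed
    then show "\<Union>\<C> \<in> ?A" using sub \<C>(1) by blast
  qed
  then obtain P where P: "subspace K P V" "U \<subseteq> P" "v \<notin> P"
    and max: "\<And>Q. subspace K Q V \<Longrightarrow> U \<subseteq> Q \<Longrightarrow> v \<notin> Q \<Longrightarrow> P \<subseteq> Q \<Longrightarrow> Q = P" by auto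
  have "\<exists>a\<in>carrier K. x \<in> P +>\<^bsub>V\<^esub> (a \<odot>\<^bsub>V\<^esub> v)" if x: "x \<in> carrier V" for x
  proof (cases "x \<in> P")
    case True
    then show ?thesis using mem_coset_zero[OF P(1)] assms(2) by (intro bexI[of _ "\<zero>\<^bsub>K\<^esub>"]) simp_all
  next
    case False
    let ?X = "(\<lambda>a. a \<odot>\<^bsub>V\<^esub> x) ` carrier K"
    have X: "subspace K ?X V"
    proof (rule subspaceI)
      show "?X \<subseteq> carrier V" using x by auto
      show "\<zero>\<^bsub>V\<^esub> \<in> ?X" using x by (intro image_eqI[of _ _ "\<zero>\<^bsub>K\<^esub>"]) simp_all
      show "y \<oplus>\<^bsub>V\<^esub> z \<in> ?X" if "y \<in> ?X" "z \<in> ?X" for y z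
        using that x by (auto simp: smult_l_distr[symmetric])
      show "a \<odot>\<^bsub>V\<^esub> y \<in> ?X" if "a \<in> carrier K" "y \<in> ?X" for a y
        using that x by (auto simp: smult_assoc1[symmetric])
    qed
    note PX = subspace_set_add[OF P(1) X] and sub = subset_set_add[OF P(1) X]
    have "\<one>\<^bsub>K\<^esub> \<odot>\<^bsub>V\<^esub> x \<in> ?X" by (rule imageI) simp
    then have "x \<in> P <+>\<^bsub>V\<^esub> ?X" using sub(2) x by auto
    \<comment> \<open>\<open>P + K x\<close> is strictly larger than \<open>P\<close>, so maximality
      forces \<open>v\<close> into it; the resulting relation is then solved for
      \<open>x\<close>.\<close>
    then have "v \<in> P <+>\<^bsub>V\<^esub> ?X" using max[OF PX] sub(1) P(2) False by auto
    then obtain w a where wa: "w \<in> P" "a \<in> carrier K" "v = w \<oplus>\<^bsub>V\<^esub> a \<odot>\<^bsub>V\<^esub> x"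
      unfolding in_set_add by auto
    have w: "w \<in> carrier V" using wa(1) subspaceD(1)[OF P(1)] by auto
    \<comment> \<open>\<open>a = 0\<close> would put \<open>v = w\<close> into
      \<open>P\<close>.\<close>
    have a: "a \<noteq> \<zero>\<^bsub>K\<^esub>" using wa x w P(3) by auto
    have eq: "a \<odot>\<^bsub>V\<^esub> x = \<ominus>\<^bsub>V\<^esub> w \<oplus>\<^bsub>V\<^esub> v"
      unfolding wa(3) using w x wa(2) by (simp only: M.r_neg1 smult_closed)
    have i: "inv\<^bsub>K\<^esub> a \<in> carrier K" using a wa(2) by simp
    have "x = inv\<^bsub>K\<^esub> a \<odot>\<^bsub>V\<^esub> (\<ominus>\<^bsub>V\<^esub> w \<oplus>\<^bsub>V\<^esub> v)"
      by (rule mult_inverse[OF wa(2) x eq a])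
    also have "\<dots> = inv\<^bsub>K\<^esub> a \<odot>\<^bsub>V\<^esub> (\<ominus>\<^bsub>V\<^esub> w) \<oplus>\<^bsub>V\<^esub> inv\<^bsub>K\<^esub> a \<odot>\<^bsub>V\<^esub> v"
      using i w assms(2) by (simp add: smult_r_distr)
    finally show ?thesis
      using subspaceD(4)[OF P(1) i subspace_minus[OF P(1) wa(1)]] i
      unfolding in_a_r_coset by blast
  qed
  then show thesis using that P by blast
qed

text \<open>\<open>quot_alg\<close> lives on sets of elements of \<open>A\<close>; here the quotient
  is realised in the target type of any \<open>q\<close> whose fibres are the cosets. Operations are
  computed on representatives picked by the section \<open>s\<close>, and the fibre condition makes
  the results independent of that choice.\<close>

lemma leibniz_quotient_model:
  fixes A :: "('k, 'a) module" and q :: "'a \<Rightarrow> 'b"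
  assumes "leibniz_algebra K A" "leibniz_ideal K I A"
    and q: "\<And>x y. x \<in> carrier A \<Longrightarrow> y \<in> carrier A \<Longrightarrow> q x = q y \<longleftrightarrow> x \<in> I +>\<^bsub>A\<^esub> y"
  obtains B :: "('k, 'b) module" where "leibniz_algebra K B" "leibniz_epi K A B I q"
proof -
  interpret A: leibniz_algebra K A by fact
  note I = leibniz_idealD(1)[OF assms(2)]
  define s where "s = inv_into (carrier A) q"
  define B where "B = \<lparr>carrier = q ` carrier A, mult = \<lambda>u v. q (s u \<otimes>\<^bsub>A\<^esub> s v), one = q \<zero>\<^bsub>A\<^esub>,
    zero = q \<zero>\<^bsub>A\<^esub>, add = \<lambda>u v. q (s u \<oplus>\<^bsub>A\<^esub> s v), smult = \<lambda>a u. q (a \<odot>\<^bsub>A\<^esub> s u)\<rparr>"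
  have s: "s (q x) \<in> carrier A" "s (q x) \<in> I +>\<^bsub>A\<^esub> x" if "x \<in> carrier A" for x
  proof -
    show 1: "s (q x) \<in> carrier A" unfolding s_def using that by (auto intro: inv_into_into)
    have "q (s (q x)) = q x" unfolding s_def using that by (auto intro: f_inv_into_f)
    then show "s (q x) \<in> I +>\<^bsub>A\<^esub> x" using q[OF 1 that] by simp
  qed
  have hom: "q \<in> leibniz_hom K A B"
  proof (rule leibniz_homI)
    fix x y assume xy: "x \<in> carrier A" "y \<in> carrier A"
    have "q (s (q x) \<oplus>\<^bsub>A\<^esub> s (q y)) = q (x \<oplus>\<^bsub>A\<^esub> y)"
      using A.coset_add[OF I s(2)[OF xy(1)] s(2)[OF xy(2)] xy] q s(1) xy by simp
    then show "q (x \<oplus>\<^bsub>A\<^esub> y) = q x \<oplus>\<^bsub>B\<^esub> q y" by (simp add: B_def)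
    have "q (s (q x) \<otimes>\<^bsub>A\<^esub> s (q y)) = q (x \<otimes>\<^bsub>A\<^esub> y)"
      using leibniz_coset_prod[OF assms(1,2) s(2)[OF xy(1)] s(2)[OF xy(2)] xy] q s(1) xy
      by (simp add: A.prod_closed)
    then show "q (x \<otimes>\<^bsub>A\<^esub> y) = q x \<otimes>\<^bsub>B\<^esub> q y" by (simp add: B_def)
  next
    fix a x assume ax: "a \<in> carrier K" "x \<in> carrier A"
    have "q (a \<odot>\<^bsub>A\<^esub> s (q x)) = q (a \<odot>\<^bsub>A\<^esub> x)"
      using A.coset_smult[OF I s(2)[OF ax(2)] ax(2,1)] q s(1) ax by simp
    then show "q (a \<odot>\<^bsub>A\<^esub> x) = a \<odot>\<^bsub>B\<^esub> q x" by (simp add: B_def)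
  qed (simp add: B_def)
  have im: "q ` carrier A = carrier B" by (simp add: B_def)
  have "leibniz_algebra K B"
    by (rule leibniz_algebra_image[OF assms(1) hom im]) (simp add: B_def)
  moreover have "leibniz_epi K A B I q" unfolding leibniz_epi_def using hom im q by simp
  ultimately show thesis by (rule that)
qed

lemma (in leibniz_algebra) prod_zero:
  assumes "x \<in> carrier L"
  shows "\<zero>\<^bsub>L\<^esub> \<otimes>\<^bsub>L\<^esub> x = \<zero>\<^bsub>L\<^esub>" "x \<otimes>\<^bsub>L\<^esub> \<zero>\<^bsub>L\<^esub> = \<zero>\<^bsub>L\<^esub>"
  using prod_smult_left[of "\<zero>\<^bsub>K\<^esub>" "\<zero>\<^bsub>L\<^esub>" x] prod_smult_right[of "\<zero>\<^bsub>K\<^esub>" x "\<zero>\<^bsub>L\<^esub>"] assms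
  by (simp_all add: prod_closed)

lemma leibniz_ideal_zero:
  assumes "leibniz_algebra K A"
  shows "leibniz_ideal K {\<zero>\<^bsub>A\<^esub>} A"
proof -
  interpret A: leibniz_algebra K A by fact
  have "subspace K {\<zero>\<^bsub>A\<^esub>} A" by (rule A.subspaceI) auto
  then show ?thesis by (simp add: leibniz_ideal_def A.prod_zero)
qed

text \<open>Projectivity of \<open>F\<close>: send each generator to a \<open>q\<close>-preimage of
  its \<open>p\<close>-value and extend. Then \<open>q \<circ> h\<close> and \<open>p\<close> agree
  on \<open>X\<close>, and their equalizer, a subalgebra, is all of \<open>F\<close>. The injection
  \<open>j\<close> is the price of a universal property tested in one type only.\<close>

lemma free_leibniz_lift:
  fixes F :: "('k, 'f) module" and C :: "('k, 'c) module" and j :: "'c \<Rightarrow> 'f list \<Rightarrow> 'k"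
  assumes free: "free_leibniz_algebra K F X" and "leibniz_algebra K L" "leibniz_algebra K C"
    and p: "p \<in> leibniz_hom K F L" and q: "q \<in> leibniz_hom K C L" "q ` carrier C = carrier L"
    and j: "inj_on j (carrier C)"
  obtains h where "h \<in> leibniz_hom K F C" "\<And>x. x \<in> carrier F \<Longrightarrow> q (h x) = p x"
proof -
  have F: "leibniz_algebra K F" "X \<subseteq> carrier F"
    and gen: "\<And>S. subspace K S F \<Longrightarrow> X \<subseteq> S \<Longrightarrow> (\<And>x y. x \<in> S \<Longrightarrow> y \<in> S \<Longrightarrow> x \<otimes>\<^bsub>F\<^esub> y \<in> S)
      \<Longrightarrow> S = carrier F"
    and ext: "\<And>(A :: ('k, 'f list \<Rightarrow> 'k) module) f. leibniz_algebra K A \<Longrightarrow> f \<in> X \<rightarrow> carrier A \<Longrightarrow>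
      \<exists>h\<in>leibniz_hom K F A. \<forall>x\<in>X. h x = f x"
    using free unfolding free_leibniz_algebra_def by auto
  interpret F: leibniz_algebra K F by fact
  interpret C: leibniz_algebra K C by fact
  have "j x = j y \<longleftrightarrow> x \<in> {\<zero>\<^bsub>C\<^esub>} +>\<^bsub>C\<^esub> y" if "x \<in> carrier C" "y \<in> carrier C" for x y
    using j that by (auto simp: in_a_r_coset inj_on_eq_iff)
  then obtain B :: "('k, 'f list \<Rightarrow> 'k) module" where
    B: "leibniz_algebra K B" "leibniz_epi K C B {\<zero>\<^bsub>C\<^esub>} j"
    using leibniz_quotient_model[OF assms(3) leibniz_ideal_zero[OF assms(3)]] by blast
  note jB = leibniz_epiD[OF B(2)]
  have "\<forall>x. \<exists>c. x \<in> carrier F \<longrightarrow> c \<in> carrier C \<and> q c = p x"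
    using leibniz_homD(1)[OF p] q(2) by (metis imageE)
  then obtain c where c: "\<And>x. x \<in> carrier F \<Longrightarrow> c x \<in> carrier C"
    "\<And>x. x \<in> carrier F \<Longrightarrow> q (c x) = p x" by metis
  have "(\<lambda>x. j (c x)) \<in> X \<rightarrow> carrier B" using c(1) F(2) jB(2)[symmetric] by auto
  then obtain h1 where h1: "h1 \<in> leibniz_hom K F B" "\<And>x. x \<in> X \<Longrightarrow> h1 x = j (c x)"
    using ext[OF B(1)] by blast
  have inv: "inv_into (carrier C) j \<in> leibniz_hom K B C"
    by (rule leibniz_hom_factor[OF assms(3) jB(1,2), of "\<lambda>x. x"])
       (auto intro: leibniz_homI simp: inv_into_f_f[OF j])
  \<comment> \<open>\<open>B\<close> is a copy of \<open>C\<close> in the type over which the universal property of \<open>F\<close> ranges.\<close>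
  define h where "h = (\<lambda>x. inv_into (carrier C) j (h1 x))"
  have h: "h \<in> leibniz_hom K F C" unfolding h_def by (rule leibniz_hom_comp[OF h1(1) inv])
  have qh: "(\<lambda>x. q (h x)) \<in> leibniz_hom K F L" by (rule leibniz_hom_comp[OF h q(1)])
  have "{x \<in> carrier F. q (h x) = p x} = carrier F"
  proof (rule gen)
    show "subspace K {x \<in> carrier F. q (h x) = p x} F"
      by (rule subspace_equalizer[OF F(1) assms(2) qh p])
    show "X \<subseteq> {x \<in> carrier F. q (h x) = p x}"
      using F(2) h1(2) c inv_into_f_f[OF j] unfolding h_def by auto
    show "x \<otimes>\<^bsub>F\<^esub> y \<in> {x \<in> carrier F. q (h x) = p x}"
      if "x \<in> {x \<in> carrier F. q (h x) = p x}" "y \<in> {x \<in> carrier F. q (h x) = p x}" for x y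
      using that leibniz_homD(3)[OF qh, of x y] leibniz_homD(3)[OF p, of x y] F.prod_closed by simp
  qed
  then show thesis using that[OF h] by blast
qed

text \<open>Used to compute \<open>C'\<close> from lifts that are correct only modulo
  \<open>M\<close>, before \<open>h\<close> is known to be onto.\<close>

lemma leibniz_center_prod:
  assumes "leibniz_algebra K A" "m \<in> leibniz_center A" "n \<in> leibniz_center A"
    "x \<in> carrier A" "y \<in> carrier A"
  shows "(m \<oplus>\<^bsub>A\<^esub> x) \<otimes>\<^bsub>A\<^esub> (n \<oplus>\<^bsub>A\<^esub> y) = x \<otimes>\<^bsub>A\<^esub> y"
proof -
  interpret A: leibniz_algebra K A by fact
  have m: "m \<in> carrier A" "\<And>z. z \<in> carrier A \<Longrightarrow> m \<otimes>\<^bsub>A\<^esub> z = \<zero>\<^bsub>A\<^esub>"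
    and n: "n \<in> carrier A" "\<And>z. z \<in> carrier A \<Longrightarrow> z \<otimes>\<^bsub>A\<^esub> n = \<zero>\<^bsub>A\<^esub>"
    using assms(2,3) by (auto simp: leibniz_center_def)
  show ?thesis using m n assms(4,5)
    by (simp add: A.prod_add_left A.prod_add_right A.prod_closed)
qed

text \<open>\<open>comm_ideal K F R \<subseteq> S\<close> makes the image of \<open>R\<close>
  central, \<open>R \<subseteq> S + F'\<close> puts it into the derived algebra of \<open>D\<close>,
  and \<open>S \<subseteq> R\<close> gives \<open>D / g(R) \<cong> F / R \<cong> L\<close>.\<close>

lemma defining_pairI:
  assumes F: "leibniz_algebra K F" and L: "leibniz_algebra K L" and D: "leibniz_algebra K D"
    and g: "leibniz_epi K F D S g" and p: "leibniz_epi K F L R p"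
    and R: "leibniz_ideal K R F" and S: "subspace K S F"
    and sub: "S \<subseteq> R" "comm_ideal K F R \<subseteq> S" "R \<subseteq> S <+>\<^bsub>F\<^esub> derived_algebra K F"
  shows "defining_pair K L D (g ` R)"
proof -
  interpret F: leibniz_algebra K F by fact
  interpret D: leibniz_algebra K D by fact
  note gD = leibniz_epiD[OF g] and RD = leibniz_idealD[OF R]
  note hom = leibniz_homD[OF gD(1)]
  have zero: "g x = \<zero>\<^bsub>D\<^esub> \<longleftrightarrow> x \<in> S" if "x \<in> carrier F" for x
    by (rule leibniz_epi_eq_zero_iff[OF F D g S that])
  have central: "g r \<otimes>\<^bsub>D\<^esub> y = \<zero>\<^bsub>D\<^esub>" "y \<otimes>\<^bsub>D\<^esub> g r = \<zero>\<^bsub>D\<^esub>" if r: "r \<in> R" and y: "y \<in> carrier D" for r y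
  proof -
    obtain x where x: "x \<in> carrier F" "y = g x" using y gD(2) by (metis imageE)
    have rF: "r \<in> carrier F" using r RD(4) by auto
    note c = comm_ideal_mem[OF F RD(4) x(1) r]
    show "g r \<otimes>\<^bsub>D\<^esub> y = \<zero>\<^bsub>D\<^esub>"
      using hom(3)[OF rF x(1)] zero[of "r \<otimes>\<^bsub>F\<^esub> x"] c(2) sub(2) x rF by (simp add: F.prod_closed subset_iff)
    show "y \<otimes>\<^bsub>D\<^esub> g r = \<zero>\<^bsub>D\<^esub>"
      using hom(3)[OF x(1) rF] zero[of "x \<otimes>\<^bsub>F\<^esub> r"] c(1) sub(2) x rF by (simp add: F.prod_closed subset_iff)
  qed
  have gR: "subspace K (g ` R) D" by (rule subspace_image[OF F D gD(1) RD(1)])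
  have ideal: "leibniz_ideal K (g ` R) D"
    unfolding leibniz_ideal_def using gR central subspaceD(2)[OF gR] by auto
  have "g ` R \<subseteq> leibniz_center D"
    unfolding leibniz_center_def using central subspaceD(1)[OF gR] by auto
  moreover have "g ` R \<subseteq> derived_algebra K D"
  proof
    fix y assume "y \<in> g ` R"
    then obtain r where r: "r \<in> R" "y = g r" by auto
    then obtain s f where sf: "s \<in> S" "f \<in> derived_algebra K F" "r = s \<oplus>\<^bsub>F\<^esub> f"
      using sub(3) unfolding subset_iff in_set_add by blast
    have c: "s \<in> carrier F" "f \<in> carrier F"
      using sf subspaceD(1)[OF S] subspaceD(1)[OF derived_algebra_subspace[OF F]] by auto
    have "y = g f" using hom(2)[OF c] hom(1)[OF c(2)] zero[OF c(1)] sf r by simp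
    then show "y \<in> derived_algebra K D"
      using sf(2) derived_algebra_image[OF F D gD(1,2)] by blast
  qed
  moreover have "leibniz_iso K (quot_alg D (g ` R)) L \<noteq> {}"
    by (rule leibniz_epi_iso_exists[OF F _ p])
       (rule leibniz_epi_comp[OF F g leibniz_epi_quot[OF D ideal] RD(1) sub(1)])
  ultimately show ?thesis unfolding defining_pair_def using D ideal by auto
qed

text \<open>The presentation is an arbitrary epimorphism \<open>p\<close> with kernel
  \<open>R\<close>, so that the lemma serves both \<open>L\<close> with \<open>R\<close> and
  \<open>L/Z\<close> with \<open>T\<close>.\<close>

lemma multiplier_iso_hopf_quot:
  fixes F :: "('k, 'f) module" and L :: "('k, 'l) module" and B :: "('k, 'm) module"
  assumes free: "free_leibniz_algebra K F X" and L: "leibniz_algebra K L"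
    and R: "leibniz_ideal K R F" and p: "leibniz_epi K F L R p" and mult: "is_multiplier K L B"
  shows "leibniz_iso K (hopf_quot K F R) B \<noteq> {}"
proof -
  have F: "leibniz_algebra K F" using free by (simp add: free_leibniz_algebra_def)
  obtain C :: "('k, 'm) module" and M where B: "B = subalg C M"
    and pair: "defining_pair K L C M" and fin: "vectorspace.fin_dim K C"
    and max: "\<And>(D :: ('k, nat \<Rightarrow> 'k) module) N. defining_pair K L D N \<Longrightarrow>
      vectorspace.fin_dim K D \<and> vectorspace.dim K D \<le> vectorspace.dim K C"
    using mult unfolding is_multiplier_def maximal_defining_pair_def by blast
  have C: "leibniz_algebra K C" and M: "leibniz_ideal K M C" "M \<subseteq> leibniz_center C" 
    "M \<subseteq> derived_algebra K C"
    using pair unfolding defining_pair_def by auto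
  obtain \<theta> where \<theta>: "\<theta> \<in> leibniz_iso K (quot_alg C M) L"
    using pair unfolding defining_pair_def by auto
  interpret F: leibniz_algebra K F by fact
  interpret C: leibniz_algebra K C by fact
  define q where "q = (\<lambda>c. \<theta> (M +>\<^bsub>C\<^esub> c))"
  have q: "leibniz_epi K C L M q"
    unfolding q_def by (rule leibniz_epi_iso[OF leibniz_epi_quot[OF C M(1)] \<theta>])
  obtain j :: "'m \<Rightarrow> 'f list \<Rightarrow> 'k" where j: "inj_on j (carrier C)"
    using C.fin_dim_inj[OF fin infinite_UNIV_listI] by blast
  obtain h where h: "h \<in> leibniz_hom K F C" and qh: "\<And>x. x \<in> carrier F \<Longrightarrow> q (h x) = p x"
    using free_leibniz_lift[OF free L C leibniz_epiD(1)[OF p] leibniz_epiD(1,2)[OF q] j] by blast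
  note hD = leibniz_homD[OF h] and pD = leibniz_epiD[OF p] and qD = leibniz_epiD[OF q]
  note RD = leibniz_idealD[OF R] and MD = leibniz_idealD[OF M(1)]
  let ?F' = "derived_algebra K F" and ?cR = "comm_ideal K F R"
  note F' = derived_algebra_subspace[OF F]
  \<comment> \<open>Surjectivity of \<open>q \<circ> h = p\<close> says only that \<open>h\<close>
    is onto modulo \<open>M\<close>.\<close>
  have lift: "\<exists>x\<in>carrier F. \<exists>m\<in>M. c = m \<oplus>\<^bsub>C\<^esub> h x" if c: "c \<in> carrier C" for c
  proof -
    obtain x where x: "x \<in> carrier F" "q c = p x"
      using leibniz_homD(1)[OF qD(1) c] pD(2) by (metis imageE)
    then have "c \<in> M +>\<^bsub>C\<^esub> h x" using qD(3)[OF c hD(1)[OF x(1)]] qh by simp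
    then show ?thesis using x(1) unfolding in_a_r_coset by blast
  qed
  \<comment> \<open>The elements of \<open>M\<close> that separate \<open>c\<close> and
    \<open>d\<close> from \<open>h x\<close> and \<open>h y\<close> are central and drop out of the
    product.\<close>
  have "derived_algebra K C \<subseteq> h ` ?F'"
    unfolding derived_algebra_def[of K C]
  proof (rule prod_span_least)
    show "subspace K (h ` ?F') C" by (rule subspace_image[OF F C h F'])
    fix c d assume "c \<in> carrier C" "d \<in> carrier C"
    then obtain x y m n where xy: "x \<in> carrier F" "y \<in> carrier F" "m \<in> M" "n \<in> M"
      "c = m \<oplus>\<^bsub>C\<^esub> h x" "d = n \<oplus>\<^bsub>C\<^esub> h y" using lift by metis
    then have "c \<otimes>\<^bsub>C\<^esub> d = h (x \<otimes>\<^bsub>F\<^esub> y)"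
      using leibniz_center_prod[OF C, of m n "h x" "h y"] M(2) hD(1,3) by auto
    then show "c \<otimes>\<^bsub>C\<^esub> d \<in> h ` ?F'" using derived_algebra_mem[OF F xy(1,2)] by simp
  qed
  then have MF': "M \<subseteq> h ` ?F'" using M(3) by simp
  \<comment> \<open>The correction terms lie in \<open>M\<close>, which is already contained in the
    image of \<open>F'\<close>.\<close>
  have surj: "h ` carrier F = carrier C"
  proof
    show "h ` carrier F \<subseteq> carrier C" using hD(1) by auto
    show "carrier C \<subseteq> h ` carrier F"
    proof
      fix c assume "c \<in> carrier C"
      then obtain x m where x: "x \<in> carrier F" "m \<in> M" "c = m \<oplus>\<^bsub>C\<^esub> h x" using lift by blast
      then obtain y where y: "y \<in> ?F'" "m = h y" using MF' by auto
      then have "y \<in> carrier F" using subspaceD(1)[OF F'] by auto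
      then show "c \<in> h ` carrier F" using hD(2)[of y x] x y by (intro image_eqI[of _ _ "y \<oplus>\<^bsub>F\<^esub> x"]) simp_all
    qed
  qed
  define W where "W = {x \<in> carrier F. h x = \<zero>\<^bsub>C\<^esub>}"
  have hW: "leibniz_epi K F C W h" unfolding W_def by (rule leibniz_epi_kernelI[OF F C h surj])
  note hWD = leibniz_epiD(3)[OF hW]
  have W: "subspace K W F"
    using subspace_preimage[OF F C h leibniz_idealD(1)[OF leibniz_ideal_zero[OF C]]] by (simp add: W_def)
  \<comment> \<open>\<open>M\<close> is the kernel of \<open>q\<close>, so by
    \<open>q \<circ> h = p\<close> its preimage under \<open>h\<close> is the kernel of
    \<open>p\<close>.\<close>
  have hM: "h x \<in> M \<longleftrightarrow> x \<in> R" if x: "x \<in> carrier F" for x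
    using leibniz_epi_eq_zero_iff[OF C L q MD(1) hD(1)[OF x]]
      leibniz_epi_eq_zero_iff[OF F L p RD(1) x] qh[OF x] by simp
  have MR: "M = h ` (R \<inter> ?F')"
  proof
    show "h ` (R \<inter> ?F') \<subseteq> M" using hM RD(4) by auto
    show "M \<subseteq> h ` (R \<inter> ?F')"
    proof
      fix m assume m: "m \<in> M"
      then obtain y where y: "y \<in> ?F'" "m = h y" using MF' by auto
      then have "y \<in> R" using hM[of y] m subspaceD(1)[OF F'] by auto
      then show "m \<in> h ` (R \<inter> ?F')" using y by auto
    qed
  qed
  have WR: "W \<subseteq> R"
  proof
    fix x assume "x \<in> W"
    then show "x \<in> R" using hM[of x] subspaceD(2)[OF MD(1)] by (simp add: W_def)
  qed
  have cW: "?cR \<subseteq> W"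
  proof (rule comm_ideal_least[OF W])
    fix x r assume x: "x \<in> carrier F" and r: "r \<in> R"
    have rF: "r \<in> carrier F" using r RD(4) by auto
    have "h r \<in> leibniz_center C" using hM[OF rF] r M(2) by auto
    then show "x \<otimes>\<^bsub>F\<^esub> r \<in> W \<and> r \<otimes>\<^bsub>F\<^esub> x \<in> W"
      using x rF hD(1,3) by (simp add: W_def leibniz_center_def F.prod_closed)
  qed
  have "v \<in> ?cR" if v: "v \<in> W" "v \<in> ?F'" for v
  proof (rule ccontr)
    assume vc: "v \<notin> ?cR"
    have vF: "v \<in> carrier F" using v(1) by (simp add: W_def)
    obtain P where P: "subspace K P F" "?cR \<subseteq> P" "v \<notin> P"
      and hyp: "\<And>x. x \<in> carrier F \<Longrightarrow> \<exists>a\<in>carrier K. x \<in> P +>\<^bsub>F\<^esub> (a \<odot>\<^bsub>F\<^esub> v)"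
      using F.hyperplane_exists[OF comm_ideal_subspace[OF F RD(4)] vF vc] by blast
    define S where "S = W \<inter> P"
    have S: "subspace K S F" unfolding S_def by (rule F.subspace_Int[OF W P(1)])
    have cS: "?cR \<subseteq> S" and SR: "S \<subseteq> R" using cW P(2) WR by (auto simp: S_def)
    obtain i :: "'m \<Rightarrow> nat \<Rightarrow> 'k" where i: "inj_on i (carrier C)"
      using C.fin_dim_inj[OF fin infinite_UNIV_nat] by blast
    define a where "a = (\<lambda>x. SOME a. a \<in> carrier K \<and> x \<in> P +>\<^bsub>F\<^esub> (a \<odot>\<^bsub>F\<^esub> v))"
    have a: "a x \<in> carrier K" "x \<in> P +>\<^bsub>F\<^esub> (a x \<odot>\<^bsub>F\<^esub> v)" if "x \<in> carrier F" for x
      using someI_ex[of "\<lambda>a. a \<in> carrier K \<and> x \<in> P +>\<^bsub>F\<^esub> (a \<odot>\<^bsub>F\<^esub> v)"] hyp[OF that]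
      unfolding a_def by blast+
    \<comment> \<open>\<open>a\<close> is a functional with kernel \<open>P\<close>, so \<open>g\<close> has the fibres of \<open>F \<rightarrow> F / (W \<inter> P)\<close>;
      it takes values in the type that carries the competitors of \<open>C\<close>.\<close>
    define g where "g = (\<lambda>x n. case n of 0 \<Rightarrow> a x | Suc n \<Rightarrow> i (h x) n)"
    have g_eq: "g x = g y \<longleftrightarrow> a x = a y \<and> i (h x) = i (h y)" for x y
      by (auto simp: g_def fun_eq_iff split: nat.split)
    have "g x = g y \<longleftrightarrow> x \<in> S +>\<^bsub>F\<^esub> y" if x: "x \<in> carrier F" and y: "y \<in> carrier F" for x y
    proof
      assume "g x = g y"
      then have eq: "a x = a y" "h x = h y"
        using i hD(1) x y by (auto simp: g_eq inj_on_eq_iff)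
      have av: "a y \<odot>\<^bsub>F\<^esub> v \<in> carrier F" using a(1)[OF y] vF by simp
      \<comment> \<open>Modulo \<open>P\<close> both \<open>x\<close> and \<open>y\<close> equal the
        same multiple of \<open>v\<close>, and modulo \<open>W\<close> they agree by
        \<open>h x = h y\<close>. The two differences are one element, which lies in
        \<open>W \<inter> P\<close>.\<close>
      have "x \<in> P +>\<^bsub>F\<^esub> (a y \<odot>\<^bsub>F\<^esub> v)" using a(2)[OF x] eq(1) by simp
      from F.mem_coset_trans[OF P(1) this F.mem_coset_sym[OF P(1) a(2)[OF y] av] y]
      obtain u where u: "u \<in> P" "x = u \<oplus>\<^bsub>F\<^esub> y" by (auto simp: in_a_r_coset)
      obtain w where w: "w \<in> W" "x = w \<oplus>\<^bsub>F\<^esub> y" using hWD[OF x y] eq(2) by (auto simp: in_a_r_coset)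
      have "u \<in> carrier F" "w \<in> carrier F" using u w subspaceD(1)[OF P(1)] by (auto simp: W_def)
      then have "u = w" using u(2) w(2) y F.M.add.right_cancel by metis
      then show "x \<in> S +>\<^bsub>F\<^esub> y" using u w unfolding in_a_r_coset S_def by blast
    next
      assume "x \<in> S +>\<^bsub>F\<^esub> y"
      then have xy: "x \<in> W +>\<^bsub>F\<^esub> y" "x \<in> P +>\<^bsub>F\<^esub> y" by (auto simp: in_a_r_coset S_def)
      have yx: "y \<in> P +>\<^bsub>F\<^esub> x" by (rule F.mem_coset_sym[OF P(1) xy(2) y])
      \<comment> \<open>\<open>x\<close> and \<open>y\<close> lie in one coset of \<open>P\<close>,
        so the predicates under \<open>SOME\<close> coincide and choose the same scalar.\<close>
      have "(b \<in> carrier K \<and> x \<in> P +>\<^bsub>F\<^esub> (b \<odot>\<^bsub>F\<^esub> v)) \<longleftrightarrow>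
          (b \<in> carrier K \<and> y \<in> P +>\<^bsub>F\<^esub> (b \<odot>\<^bsub>F\<^esub> v))" for b
        using F.mem_coset_trans[OF P(1) xy(2)] F.mem_coset_trans[OF P(1) yx] vF by auto
      then have "a x = a y" by (simp add: a_def)
      then show "g x = g y" using hWD[OF x y] xy(1) by (simp add: g_eq)
    qed
    then obtain D :: "('k, nat \<Rightarrow> 'k) module" where D: "leibniz_algebra K D" "leibniz_epi K F D S g"
      using leibniz_quotient_model[OF F leibniz_ideal_between[OF F R S cS SR]] by blast
    note gD = leibniz_epiD[OF D(2)]
    \<comment> \<open>\<open>M = h(R \<inter> F')\<close> gives \<open>r = w + y\<close> with
      \<open>w\<close> in \<open>W\<close> and \<open>y\<close> in \<open>F'\<close>. Split
      \<open>w = u + ?av\<close> along the hyperplane: \<open>?av\<close> lies in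
      \<open>W \<inter> F'\<close> because \<open>v\<close> does, so \<open>u\<close> is in
      \<open>W \<inter> P\<close>, and \<open>?av\<close> joins \<open>y\<close> in
      \<open>F'\<close>.\<close>
    have "R \<subseteq> S <+>\<^bsub>F\<^esub> ?F'"
    proof
      fix r assume r: "r \<in> R"
      have rF: "r \<in> carrier F" using r RD(4) by auto
      have "h r \<in> h ` (R \<inter> ?F')" using hM[OF rF] r MR by simp
      then obtain y where y: "y \<in> ?F'" "h r = h y" by auto
      have yF: "y \<in> carrier F" using y subspaceD(1)[OF F'] by auto
      obtain w where w: "w \<in> W" "r = w \<oplus>\<^bsub>F\<^esub> y" using hWD[OF rF yF] y(2) by (auto simp: in_a_r_coset)
      have wF: "w \<in> carrier F" using w(1) by (simp add: W_def)
      let ?av = "a w \<odot>\<^bsub>F\<^esub> v"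
      obtain u where u: "u \<in> P" "w = u \<oplus>\<^bsub>F\<^esub> ?av" using a(2)[OF wF] by (auto simp: in_a_r_coset)
      have uF: "u \<in> carrier F" using u(1) subspaceD(1)[OF P(1)] by auto
      have avW: "?av \<in> W" and avF': "?av \<in> ?F'"
        using subspaceD(4)[OF W a(1)[OF wF] v(1)] subspaceD(4)[OF F' a(1)[OF wF] v(2)] by auto
      have "u \<in> W" using F.subspace_cancel(2)[OF W avW uF] w(1) u(2) by simp
      then have "u \<in> S" using u(1) by (simp add: S_def)
      moreover have "?av \<oplus>\<^bsub>F\<^esub> y \<in> ?F'" by (rule subspaceD(3)[OF F' avF' y(1)])
      moreover have "r = u \<oplus>\<^bsub>F\<^esub> (?av \<oplus>\<^bsub>F\<^esub> y)"
        unfolding w(2) using uF yF a(1)[OF wF] vF by (subst u(2)) (simp add: F.M.a_assoc)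
      ultimately show "r \<in> S <+>\<^bsub>F\<^esub> ?F'" unfolding in_set_add by blast
    qed
    then have "defining_pair K L D (g ` R)"
      by (rule defining_pairI[OF F L D(1,2) p R S SR cS])
    then have dim: "vectorspace.fin_dim K D" "vectorspace.dim K D \<le> vectorspace.dim K C"
      using max by blast+
    \<comment> \<open>\<open>k\<close> is the projection of \<open>F / (W \<inter> P)\<close> onto
      \<open>F / W\<close>, read as a map from \<open>D\<close> to \<open>C\<close>. It kills
      \<open>g v\<close>, which is nonzero because \<open>v\<close> avoids \<open>P\<close>.\<close>
    define k where "k = (\<lambda>d. h (inv_into (carrier F) g d))"
    have kg: "k (g x) = h x" if x: "x \<in> carrier F" for x
    proof -
      have "inv_into (carrier F) g (g x) \<in> carrier F" "g (inv_into (carrier F) g (g x)) = g x"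
        using x by (auto intro: inv_into_into f_inv_into_f)
      then show ?thesis unfolding k_def using i hD(1) x by (auto simp: g_eq inj_on_eq_iff)
    qed
    have k: "k \<in> leibniz_hom K D C" by (rule leibniz_hom_factor[OF F gD(1,2) h]) (rule kg)
    have "vectorspace.dim K C < vectorspace.dim K D"
    proof (rule dim_less_of_kernel[OF dim(1)])
      show "k ` carrier D = carrier C"
        unfolding gD(2)[symmetric] surj[symmetric] image_image using kg by simp
      show "g v \<in> carrier D" using gD(2) vF by blast
      show "g v \<noteq> \<zero>\<^bsub>D\<^esub>"
        using leibniz_epi_eq_zero_iff[OF F D S vF] P(3) by (simp add: S_def)
      show "k (g v) = \<zero>\<^bsub>C\<^esub>" using kg[OF vF] v(1) by (simp add: W_def)
      show "linear_map K D C k" by (rule leibniz_hom_linear_map[OF D(1) C k])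
    qed
    then show False using dim(2) by simp
  qed
  then have key: "W \<inter> ?F' \<subseteq> ?cR" by auto
  have RF': "leibniz_ideal K (R \<inter> ?F') F" by (intro leibniz_ideal_Int R derived_algebra_ideal F)
  have "leibniz_epi K (subalg F (R \<inter> ?F')) (subalg C M) ?cR h"
    unfolding leibniz_epi_def
  proof (intro conjI ballI)
    show "h \<in> leibniz_hom K (subalg F (R \<inter> ?F')) (subalg C M)"
      using hD RD(4) MR by (intro leibniz_homI) (simp_all add: subset_iff)
    show "h ` carrier (subalg F (R \<inter> ?F')) = carrier (subalg C M)" by (simp add: MR)
    fix x y assume "x \<in> carrier (subalg F (R \<inter> ?F'))" "y \<in> carrier (subalg F (R \<inter> ?F'))"
    then have xy: "x \<in> carrier F" "y \<in> carrier F" "x \<in> ?F'" "y \<in> ?F'" using RD(4) by auto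
    \<comment> \<open>Differences of elements of \<open>F'\<close> stay in \<open>F'\<close>, so on
      this domain the kernel of \<open>h\<close> shrinks to \<open>W \<inter> F'\<close>, which
      equals \<open>comm_ideal K F R\<close>.\<close>
    have "x \<in> W +>\<^bsub>F\<^esub> y \<longleftrightarrow> x \<in> ?cR +>\<^bsub>F\<^esub> y"
    proof
      assume "x \<in> W +>\<^bsub>F\<^esub> y"
      then obtain w where w: "w \<in> W" "x = w \<oplus>\<^bsub>F\<^esub> y" by (auto simp: in_a_r_coset)
      then have "w \<in> ?F'" using F.subspace_cancel(2)[OF F' xy(4), of w] xy(3) by (simp add: W_def)
      then show "x \<in> ?cR +>\<^bsub>F\<^esub> y" using w key unfolding in_a_r_coset by blast
    next
      show "x \<in> ?cR +>\<^bsub>F\<^esub> y \<Longrightarrow> x \<in> W +>\<^bsub>F\<^esub> y" using cW unfolding in_a_r_coset by blast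
    qed
    then show "h x = h y \<longleftrightarrow> x \<in> ?cR +>\<^bsub>subalg F (R \<inter> ?F')\<^esub> y" using hWD[OF xy(1,2)] by simp
  qed
  then show ?thesis unfolding B
    by (rule leibniz_epi_iso_exists[OF leibniz_algebra_ideal[OF F RF'] leibniz_epi_hopf_quot[OF F R]])
qed

section \<open>The exact sequence\<close>

lemma leibniz_hom_image_set_add:
  assumes "h \<in> leibniz_hom K A B" "S \<subseteq> carrier A" "T \<subseteq> carrier A"
  shows "h ` (S <+>\<^bsub>A\<^esub> T) = h ` S <+>\<^bsub>B\<^esub> h ` T"
proof (intro Set.set_eqI iffI)
  fix y assume "y \<in> h ` (S <+>\<^bsub>A\<^esub> T)"
  then obtain s t where st: "s \<in> S" "t \<in> T" "y = h (s \<oplus>\<^bsub>A\<^esub> t)"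
    by (auto simp: in_set_add)
  then have "y = h s \<oplus>\<^bsub>B\<^esub> h t" using leibniz_homD(2)[OF assms(1), of s t] assms(2,3) by blast
  then show "y \<in> h ` S <+>\<^bsub>B\<^esub> h ` T" using st unfolding in_set_add by blast
next
  fix y assume "y \<in> h ` S <+>\<^bsub>B\<^esub> h ` T"
  then obtain s t where st: "s \<in> S" "t \<in> T" "y = h s \<oplus>\<^bsub>B\<^esub> h t" by (auto simp: in_set_add)
  then have "y = h (s \<oplus>\<^bsub>A\<^esub> t)" using leibniz_homD(2)[OF assms(1), of s t] assms(2,3) by (metis subsetD)
  moreover have "s \<oplus>\<^bsub>A\<^esub> t \<in> S <+>\<^bsub>A\<^esub> T" using st unfolding in_set_add by blast
  ultimately show "y \<in> h ` (S <+>\<^bsub>A\<^esub> T)" by simp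
qed

theorem corollary4p3:
  fixes K :: "'k ring"
    and L :: "('k, 'l) module" and Z :: "'l set"
    and F :: "('k, 'f) module" and X R T :: "'f set" and \<pi> :: "'f set \<Rightarrow> 'l"
    and M :: "('k, 'm) module" and MQ :: "('k, 'n) module"
  defines "L' \<equiv> derived_algebra K L" and "F' \<equiv> derived_algebra K F"
  defines "\<phi>4 \<equiv> quot_map L L' (\<lambda>x. \<pi> (R +>\<^bsub>F\<^esub> x))"
    and "\<phi>5 \<equiv> quot_map L (Z <+>\<^bsub>L\<^esub> L') (\<lambda>x. \<pi> (R +>\<^bsub>F\<^esub> x))"
  assumes "leibniz_algebra K L" and "central_ideal K Z L"
    and "free_leibniz_algebra K F X"
    and "leibniz_ideal K R F" and "leibniz_ideal K T F" and "R \<subseteq> T"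
    and "\<pi> \<in> leibniz_iso K (quot_alg F R) L"
    and "\<pi> ` carrier (quot_alg (subalg F T) R) = Z"
  shows "(is_multiplier K L M \<longrightarrow> leibniz_iso K (hopf_quot K F R) M \<noteq> {})
    \<and> (is_multiplier K (quot_alg L Z) MQ \<longrightarrow> leibniz_iso K (hopf_quot K F T) MQ \<noteq> {})
    \<and> \<pi> \<in> leibniz_iso K (quot_alg (subalg F T) R) (subalg L Z)
    \<and> \<phi>4 \<in> leibniz_iso K (quot_alg F (R <+>\<^bsub>F\<^esub> F')) (quot_alg L L')
    \<and> \<phi>5 \<in> leibniz_iso K (quot_alg F (T <+>\<^bsub>F\<^esub> F')) (quot_alg L (Z <+>\<^bsub>L\<^esub> L'))
    \<and> (\<forall>\<phi>1 \<in> leibniz_iso K (hopf_quot K F R) M. \<forall>\<phi>2 \<in> leibniz_iso K (hopf_quot K F T) MQ.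
        let d1 = transport_map (hopf_quot K F R) \<phi>1 \<phi>2 (quot_map F (comm_ideal K F T) id);
            d2 = transport_map (hopf_quot K F T) \<phi>2 \<pi> (quot_map F R id);
            d3 = transport_map (quot_alg (subalg F T) R) \<pi> \<phi>4 (quot_map F (R <+>\<^bsub>F\<^esub> F') id);
            d4 = transport_map (quot_alg F (R <+>\<^bsub>F\<^esub> F')) \<phi>4 \<phi>5 (quot_map F (T <+>\<^bsub>F\<^esub> F') id)
        in exact_at K M d1 MQ d2 (subalg L Z)
          \<and> exact_at K MQ d2 (subalg L Z) d3 (quot_alg L L')
          \<and> exact_at K (subalg L Z) d3 (quot_alg L L') d4 (quot_alg L (Z <+>\<^bsub>L\<^esub> L'))
          \<and> d4 ` carrier (quot_alg L L') = carrier (quot_alg L (Z <+>\<^bsub>L\<^esub> L')))"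
proof -
  note L = assms(5) and R = assms(8) and T = assms(9) and RT = assms(10)
  have F: "leibniz_algebra K F" using assms(7) by (simp add: free_leibniz_algebra_def)
  have Z: "leibniz_ideal K Z L" "Z \<subseteq> leibniz_center L"
    using assms(6) by (auto simp: central_ideal_def)
  interpret F: leibniz_algebra K F by fact
  interpret L: leibniz_algebra K L by fact
  \<comment> \<open>Every term is presented by an ideal of \<open>F\<close>: the last three through
    this composite \<open>F \<rightarrow> L\<close>, the multipliers through \<open>\<phi>1\<close>
    and \<open>\<phi>2\<close>.\<close>
  define p where "p = (\<lambda>x. \<pi> (R +>\<^bsub>F\<^esub> x))"
  have p: "leibniz_epi K F L R p"
    unfolding p_def by (rule leibniz_epi_iso[OF leibniz_epi_quot[OF F R] assms(11)])
  note pD = leibniz_epiD[OF p]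
  note hom = leibniz_homD[OF pD(1)]
  note RD = leibniz_idealD[OF R] and TD = leibniz_idealD[OF T] and ZD = leibniz_idealD[OF Z(1)]
  have F': "leibniz_ideal K F' F" and L': "leibniz_ideal K L' L"
    unfolding F'_def L'_def by (rule derived_algebra_ideal[OF F] derived_algebra_ideal[OF L])+
  note F'D = leibniz_idealD[OF F'] and L'D = leibniz_idealD[OF L']
  let ?RF = "R <+>\<^bsub>F\<^esub> F'" and ?TF = "T <+>\<^bsub>F\<^esub> F'" and ?ZL = "Z <+>\<^bsub>L\<^esub> L'"
  have RF: "leibniz_ideal K ?RF F" and TF: "leibniz_ideal K ?TF F" and ZL: "leibniz_ideal K ?ZL L"
    using leibniz_idealI_derived[OF F F.subspace_set_add[OF RD(1) F'D(1)]]
      leibniz_idealI_derived[OF F F.subspace_set_add[OF TD(1) F'D(1)]]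
      leibniz_idealI_derived[OF L L.subspace_set_add[OF ZD(1) L'D(1)]]
      F.subset_set_add(2)[OF RD(1) F'D(1)] F.subset_set_add(2)[OF TD(1) F'D(1)]
      L.subset_set_add(2)[OF ZD(1) L'D(1)]
    unfolding F'_def L'_def by simp_all
  note RFD = leibniz_idealD[OF RF] and TFD = leibniz_idealD[OF TF] and ZLD = leibniz_idealD[OF ZL]
  have R_RF: "R \<subseteq> ?RF" and F'_RF: "F' \<subseteq> ?RF" and T_TF: "T \<subseteq> ?TF" and F'_TF: "F' \<subseteq> ?TF"
    using F.subset_set_add[OF RD(1) F'D(1)] F.subset_set_add[OF TD(1) F'D(1)] by auto
  have R_TF: "R \<subseteq> ?TF" using RT T_TF by auto
  have p0: "p x = \<zero>\<^bsub>L\<^esub> \<longleftrightarrow> x \<in> R" if "x \<in> carrier F" for x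
    by (rule leibniz_epi_eq_zero_iff[OF F L p RD(1) that])
  have pT: "p ` T = Z" using assms(12) by (simp add: p_def image_image)
  have pF': "p ` F' = L'"
    unfolding F'_def L'_def by (rule derived_algebra_image[OF F L pD(1,2)])
  have pTF: "p ` ?TF = ?ZL"
    using leibniz_hom_image_set_add[OF pD(1) TD(4) F'D(4)] pT pF' by simp
  have pR: "p ` R = {\<zero>\<^bsub>L\<^esub>}"
  proof
    show "p ` R \<subseteq> {\<zero>\<^bsub>L\<^esub>}" using p0 RD(4) by auto
    show "{\<zero>\<^bsub>L\<^esub>} \<subseteq> p ` R" using p0[of "\<zero>\<^bsub>F\<^esub>"] subspaceD(2)[OF RD(1)] by (simp add: image_iff) metis
  qed
  have "p ` ?RF = {\<zero>\<^bsub>L\<^esub>} <+>\<^bsub>L\<^esub> L'"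
    using leibniz_hom_image_set_add[OF pD(1) RD(4) F'D(4)] pR pF' by simp
  also have "\<dots> = L'"
  proof
    show "{\<zero>\<^bsub>L\<^esub>} <+>\<^bsub>L\<^esub> L' \<subseteq> L'"
      by (rule set_add_subset[OF L'D(1)]) (use subspaceD(2)[OF L'D(1)] in auto)
    show "L' \<subseteq> {\<zero>\<^bsub>L\<^esub>} <+>\<^bsub>L\<^esub> L'"
      by (rule L.subset_set_add(2)[OF leibniz_idealD(1)[OF leibniz_ideal_zero[OF L]] L'D(1)])
  qed
  finally have pRF: "p ` ?RF = L'" .

  let ?cR = "comm_ideal K F R" and ?cT = "comm_ideal K F T"
  have cT: "?cT \<subseteq> R" "?cT \<subseteq> F'" "subspace K ?cT F"
  proof -
    \<comment> \<open>\<open>T\<close> maps into the centre of \<open>L\<close>, so its products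
      with \<open>F\<close> vanish there. This makes the map from \<open>hopf_quot K F T\<close> to
      \<open>Z\<close> well defined.\<close>
    show "?cT \<subseteq> R"
    proof (rule comm_ideal_least[OF RD(1)])
      fix x t assume x: "x \<in> carrier F" and t: "t \<in> T"
      have tF: "t \<in> carrier F" using t TD(4) by auto
      have "p t \<in> leibniz_center L" using t pT Z(2) by auto
      then have "p (x \<otimes>\<^bsub>F\<^esub> t) = \<zero>\<^bsub>L\<^esub>" "p (t \<otimes>\<^bsub>F\<^esub> x) = \<zero>\<^bsub>L\<^esub>"
        using hom(1)[OF x] hom(3)[OF x tF] hom(3)[OF tF x] by (simp_all add: leibniz_center_def)
      then show "x \<otimes>\<^bsub>F\<^esub> t \<in> R \<and> t \<otimes>\<^bsub>F\<^esub> x \<in> R"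
        using p0 F.prod_closed x tF by simp
    qed
    show "?cT \<subseteq> F'" unfolding F'_def by (rule comm_ideal_subset(2)[OF F T])
    show "subspace K ?cT F" by (rule comm_ideal_subspace[OF F TD(4)])
  qed
  have cR: "subspace K ?cR F" by (rule comm_ideal_subspace[OF F RD(4)])
  have cRT: "?cR \<subseteq> ?cT"
    by (rule comm_ideal_least[OF cT(3)]) (use comm_ideal_mem[OF F TD(4)] RT in blast)

  have e4: "leibniz_epi K F (quot_alg L L') ?RF (\<lambda>x. L' +>\<^bsub>L\<^esub> p x)"
    by (rule leibniz_epi_comp[OF F p _ RFD(1) R_RF]) (unfold pRF, rule leibniz_epi_quot[OF L L'])
  have e5: "leibniz_epi K F (quot_alg L ?ZL) ?TF (\<lambda>x. ?ZL +>\<^bsub>L\<^esub> p x)"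
    by (rule leibniz_epi_comp[OF F p _ TFD(1) R_TF]) (unfold pTF, rule leibniz_epi_quot[OF L ZL])
  \<comment> \<open>Presents \<open>L/Z\<close> as \<open>F/T\<close>, which is what the Hopf
    formula for \<open>MQ\<close> requires.\<close>
  have eZ: "leibniz_epi K F (quot_alg L Z) T (\<lambda>x. Z +>\<^bsub>L\<^esub> p x)"
    by (rule leibniz_epi_comp[OF F p _ TD(1) RT]) (unfold pT, rule leibniz_epi_quot[OF L Z(1)])
  have e3: "leibniz_epi K (subalg F T) (subalg L Z) R p"
    unfolding leibniz_epi_def
  proof (intro conjI ballI)
    show "p \<in> leibniz_hom K (subalg F T) (subalg L Z)"
      using hom TD(4) pT by (intro leibniz_homI) (auto simp: subset_iff)
    show "p ` carrier (subalg F T) = carrier (subalg L Z)" using pT by simp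
    show "p x = p y \<longleftrightarrow> x \<in> R +>\<^bsub>subalg F T\<^esub> y"
      if "x \<in> carrier (subalg F T)" "y \<in> carrier (subalg F T)" for x y
      using that pD(3) TD(4) by auto
  qed
  have sT: "leibniz_algebra K (subalg F T)" by (rule leibniz_algebra_ideal[OF F T])
  have TF': "leibniz_ideal K (T \<inter> F') F" and RF': "leibniz_ideal K (R \<inter> F') F"
    by (rule leibniz_ideal_Int[OF T F'] leibniz_ideal_Int[OF R F'])+

  have \<phi>4: "\<phi>4 (?RF +>\<^bsub>F\<^esub> x) = L' +>\<^bsub>L\<^esub> p x" if "x \<in> carrier F" for x
    unfolding \<phi>4_def p_def[symmetric]
    by (rule quot_map_coset[OF F.vectorspace_axioms L.vectorspace_axioms RFD(1) L'D(1) hom(1,2) _ that])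
       (auto simp: pRF)
  have \<phi>5: "\<phi>5 (?TF +>\<^bsub>F\<^esub> x) = ?ZL +>\<^bsub>L\<^esub> p x" if "x \<in> carrier F" for x
    unfolding \<phi>5_def p_def[symmetric]
    by (rule quot_map_coset[OF F.vectorspace_axioms L.vectorspace_axioms TFD(1) ZLD(1) hom(1,2) _ that])
       (auto simp: pTF)
  have iso3: "\<pi> \<in> leibniz_iso K (quot_alg (subalg F T) R) (subalg L Z)"
    by (rule leibniz_iso_factor[OF sT leibniz_epi_quot_subalg[OF F T R RT] e3]) (simp add: p_def)
  have iso4: "\<phi>4 \<in> leibniz_iso K (quot_alg F ?RF) (quot_alg L L')"
    by (rule leibniz_iso_factor[OF F leibniz_epi_quot[OF F RF] e4]) (rule \<phi>4)
  have iso5: "\<phi>5 \<in> leibniz_iso K (quot_alg F ?TF) (quot_alg L ?ZL)"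
    by (rule leibniz_iso_factor[OF F leibniz_epi_quot[OF F TF] e5]) (rule \<phi>5)

  have inclusion: "quot_map F W id (I +>\<^bsub>F\<^esub> x) = W +>\<^bsub>F\<^esub> x"
    if "subspace K I F" "subspace K W F" "I \<subseteq> W" "x \<in> carrier F" for I W x
    using quot_map_coset[OF F.vectorspace_axioms F.vectorspace_axioms that(1,2), of id] that(3,4) by simp

  \<comment> \<open>\<open>M\<close> and \<open>MQ\<close> are arbitrary records here, seen only
    through \<open>\<phi>1\<close> and \<open>\<phi>2\<close>; exactness therefore holds for every
    choice of these identifications.\<close>
  have exact: "exact_at K M d1 MQ d2 (subalg L Z)
      \<and> exact_at K MQ d2 (subalg L Z) d3 (quot_alg L L')
      \<and> exact_at K (subalg L Z) d3 (quot_alg L L') d4 (quot_alg L ?ZL)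
      \<and> d4 ` carrier (quot_alg L L') = carrier (quot_alg L ?ZL)"
    if iso1: "\<phi>1 \<in> leibniz_iso K (hopf_quot K F R) M" and iso2: "\<phi>2 \<in> leibniz_iso K (hopf_quot K F T) MQ"
      and d1: "d1 = transport_map (hopf_quot K F R) \<phi>1 \<phi>2 (quot_map F ?cT id)"
      and d2: "d2 = transport_map (hopf_quot K F T) \<phi>2 \<pi> (quot_map F R id)"
      and d3: "d3 = transport_map (quot_alg (subalg F T) R) \<pi> \<phi>4 (quot_map F ?RF id)"
      and d4: "d4 = transport_map (quot_alg F ?RF) \<phi>4 \<phi>5 (quot_map F ?TF id)"
    for \<phi>1 \<phi>2 d1 d2 d3 d4
  proof -
    note hR = leibniz_epi_hopf_quot[OF F R, folded F'_def]
      and hT = leibniz_epi_hopf_quot[OF F T, folded F'_def]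
    note e1 = leibniz_epi_iso[OF hR iso1] and e2 = leibniz_epi_iso[OF hT iso2]
    \<comment> \<open>On representatives in \<open>F\<close> each map is the identity;
      \<open>q1\<close> to \<open>q4\<close> record this after transport, in the form that
      \<open>exact_atI\<close> expects.\<close>
    have q1: "d1 (\<phi>1 (?cR +>\<^bsub>F\<^esub> x)) = \<phi>2 (?cT +>\<^bsub>F\<^esub> x)" if x: "x \<in> R \<inter> F'" for x
    proof -
      have "?cR +>\<^bsub>F\<^esub> x \<in> carrier (hopf_quot K F R)"
        using x leibniz_epiD(2)[OF hR] by auto
      moreover have "x \<in> carrier F" using x RD(4) by auto
      ultimately show ?thesis unfolding d1
        by (simp add: transport_map_apply[OF iso1] inclusion[OF cR cT(3) cRT])
    qed
    have q2: "d2 (\<phi>2 (?cT +>\<^bsub>F\<^esub> x)) = p x" if x: "x \<in> T \<inter> F'" for x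
    proof -
      have "?cT +>\<^bsub>F\<^esub> x \<in> carrier (hopf_quot K F T)"
        using x leibniz_epiD(2)[OF hT] by auto
      moreover have "x \<in> carrier F" using x TD(4) by auto
      ultimately show ?thesis unfolding d2
        by (simp add: transport_map_apply[OF iso2] inclusion[OF cT(3) RD(1) cT(1)] p_def)
    qed
    have q3: "d3 (p x) = L' +>\<^bsub>L\<^esub> p x" if x: "x \<in> T" for x
    proof -
      have "R +>\<^bsub>F\<^esub> x \<in> carrier (quot_alg (subalg F T) R)" using x by simp
      moreover have "x \<in> carrier F" using x TD(4) by auto
      ultimately show ?thesis unfolding d3
        by (simp add: p_def transport_map_apply[OF iso3] inclusion[OF RD(1) RFD(1) R_RF] \<phi>4)
    qed
    have q4: "d4 (L' +>\<^bsub>L\<^esub> p x) = ?ZL +>\<^bsub>L\<^esub> p x" if x: "x \<in> carrier F" for x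
    proof -
      have "?RF \<subseteq> ?TF" using R_TF F'_TF by (intro set_add_subset[OF TFD(1)])
      moreover have "?RF +>\<^bsub>F\<^esub> x \<in> carrier (quot_alg F ?RF)" using x by simp
      \<comment> \<open>\<open>transport_map\<close> inverts \<open>\<phi>4\<close>, so the argument
        is first rewritten backwards into a value of \<open>\<phi>4\<close>.\<close>
      ultimately show ?thesis unfolding d4
        using x inclusion[OF RFD(1) TFD(1)]
        by (simp add: transport_map_apply[OF iso4] \<phi>5 flip: \<phi>4)
    qed
    \<comment> \<open>\<open>exact_atI\<close> speaks of subalgebras, so \<open>F\<close> is read as
      \<open>subalg F (carrier F)\<close>.\<close>
    have s: "leibniz_algebra K (subalg F (carrier F))"
      and e4': "leibniz_epi K (subalg F (carrier F)) (quot_alg L L') ?RF (\<lambda>x. L' +>\<^bsub>L\<^esub> p x)"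
      and e5': "leibniz_epi K (subalg F (carrier F)) (quot_alg L ?ZL) ?TF (\<lambda>x. ?ZL +>\<^bsub>L\<^esub> p x)"
      using F e4 e5 by simp_all
    have x1: "exact_at K M d1 MQ d2 (subalg L Z)"
    proof (rule exact_atI[OF leibniz_algebra_ideal[OF F RF'] leibniz_algebra_ideal[OF F TF'] e1 e2 e3 _ _ _ q1 q2])
      show "R \<inter> F' \<subseteq> T \<inter> F'" "T \<inter> F' \<subseteq> T" using RT by auto
      show "p x = \<zero>\<^bsub>subalg L Z\<^esub> \<longleftrightarrow> x \<in> R" if "x \<in> T" for x using p0 that TD(4) by auto
      \<comment> \<open>Both sides equal \<open>R \<inter> F'\<close>, since
        \<open>R \<subseteq> T\<close> and \<open>FT + TF \<subseteq> R \<inter> F'\<close>.\<close>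
      show "T \<inter> F' \<inter> R = ?cT <+>\<^bsub>F\<^esub> (R \<inter> F')"
      proof
        show "T \<inter> F' \<inter> R \<subseteq> ?cT <+>\<^bsub>F\<^esub> (R \<inter> F')"
          using F.subset_set_add(2)[OF cT(3) leibniz_idealD(1)[OF RF']] by auto
        have "?cT <+>\<^bsub>F\<^esub> (R \<inter> F') \<subseteq> R \<inter> F'"
          by (rule set_add_subset[OF leibniz_idealD(1)[OF RF']]) (use cT in auto)
        then show "?cT <+>\<^bsub>F\<^esub> (R \<inter> F') \<subseteq> T \<inter> F' \<inter> R" using RT by auto
      qed
    qed
    have x2: "exact_at K MQ d2 (subalg L Z) d3 (quot_alg L L')"
    proof (rule exact_atI[OF leibniz_algebra_ideal[OF F TF'] sT e2 e3 e4' _ _ _ q2 q3])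
      show "T \<inter> F' \<subseteq> T" "T \<subseteq> carrier F" using TD(4) by auto
      show "L' +>\<^bsub>L\<^esub> p x = \<zero>\<^bsub>quot_alg L L'\<^esub> \<longleftrightarrow> x \<in> ?RF" if "x \<in> carrier F" for x
        by (rule leibniz_epi_eq_zero_iff[OF F leibniz_algebra_quot[OF L L'] e4 RFD(1) that])
      show "T \<inter> ?RF = R <+>\<^bsub>F\<^esub> (T \<inter> F')"
      proof
        show "T \<inter> ?RF \<subseteq> R <+>\<^bsub>F\<^esub> (T \<inter> F')"
        proof
          fix x assume x: "x \<in> T \<inter> ?RF"
          then obtain r f where rf: "r \<in> R" "f \<in> F'" "x = r \<oplus>\<^bsub>F\<^esub> f" by (auto simp: in_set_add)
          \<comment> \<open>Modular law: \<open>r\<close> lies in \<open>R \<subseteq> T\<close>, so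
            \<open>r + f \<in> T\<close> forces \<open>f \<in> T\<close>.\<close>
          have "f \<in> T" using F.subspace_cancel(1)[OF TD(1), of r f] rf x RT F'D(4) by auto
          then show "x \<in> R <+>\<^bsub>F\<^esub> (T \<inter> F')" using rf unfolding in_set_add by blast
        qed
        show "R <+>\<^bsub>F\<^esub> (T \<inter> F') \<subseteq> T \<inter> ?RF"
          by (rule set_add_subset[OF F.subspace_Int[OF TD(1) RFD(1)]]) (use RT R_RF F'_RF in auto)
      qed
    qed
    have x3: "exact_at K (subalg L Z) d3 (quot_alg L L') d4 (quot_alg L ?ZL)"
    proof (rule exact_atI[OF sT s e3 e4' e5' _ _ _ q3 q4])
      show "T \<subseteq> carrier F" by (rule TD(4))
      show "?ZL +>\<^bsub>L\<^esub> p x = \<zero>\<^bsub>quot_alg L ?ZL\<^esub> \<longleftrightarrow> x \<in> ?TF" if "x \<in> carrier F" for x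
        by (rule leibniz_epi_eq_zero_iff[OF F leibniz_algebra_quot[OF L ZL] e5 TFD(1) that])
      \<comment> \<open>As \<open>R \<subseteq> T\<close>, adding \<open>T\<close> to
        \<open>R + F'\<close> gives \<open>T + F'\<close>.\<close>
      show "carrier F \<inter> ?TF = ?RF <+>\<^bsub>F\<^esub> T"
      proof
        note sub = F.subset_set_add[OF RFD(1) TD(1)]
        have "?TF \<subseteq> ?RF <+>\<^bsub>F\<^esub> T"
          by (rule set_add_subset[OF F.subspace_set_add[OF RFD(1) TD(1)]]) (use sub F'_RF in auto)
        then show "carrier F \<inter> ?TF \<subseteq> ?RF <+>\<^bsub>F\<^esub> T" by auto
        have "?RF <+>\<^bsub>F\<^esub> T \<subseteq> ?TF"
          by (rule set_add_subset[OF TFD(1) set_add_subset[OF TFD(1) R_TF F'_TF] T_TF])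
        then show "?RF <+>\<^bsub>F\<^esub> T \<subseteq> carrier F \<inter> ?TF" using TFD(4) by auto
      qed
    qed simp
    \<comment> \<open>Both quotients are images of \<open>F\<close>, and \<open>d4\<close> commutes
      with the projections by \<open>q4\<close>.\<close>
    have "d4 ` carrier (quot_alg L L') = carrier (quot_alg L ?ZL)"
      unfolding leibniz_epiD(2)[OF e4, symmetric] leibniz_epiD(2)[OF e5, symmetric] image_image
      by (rule image_cong[OF refl q4])
    then show ?thesis using x1 x2 x3 by blast
  qed

  show ?thesis
    unfolding Let_def
    by (intro conjI[OF _ conjI[OF _ conjI[OF iso3 conjI[OF iso4 conjI[OF iso5]]]]] ballI impI
        multiplier_iso_hopf_quot[OF assms(7) L R p]
        multiplier_iso_hopf_quot[OF assms(7) leibniz_algebra_quot[OF L Z(1)] T eZ])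
      (assumption | rule exact[OF _ _ refl refl refl refl])+
qed

end
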